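(* Assume $\omega_a\ne0$ and $\omega_{-b}\ne0$. Then, in $K[u][[z]]$, $$\sum_{k\ge0}\sum_{\ell=0}^{k}F_{k,\ell}\,u^\ell z^k=\frac{\widetilde N(u,z)}{\widetilde D(uz)\,D(z)},$$ where $D(z)=\det(1-z\mathbf T)$, $\widetilde D(z)=\det(1-z\widetilde{\mathbf T})$, and $\widetilde N(u,z)$ is the $(\widetilde I_0,I_0)$ entry of the matrix $\operatorname{adj}(1-uz\widetilde{\mathbf T})\,\mathbf U\,\operatorname{adj}(1-z\mathbf T)$ (adj denoting the adjugate, i.e. the transposed cofactor matrix), a polynomial in $u,z$. Moreover $D(z)$ has degree $\binom{a+b}{a}$, $\widetilde D(z)$ has degree $\binom{a+b}{a-1}$, and, as a polynomial in $z$, $\widetilde N(u,z)$ has degree $\binom{a+b+1}{a}-a-b-1$ with leading coefficient equal to $c\,u^{\binom{a+b}{a-1}-a}$ for some nonzero $c\in K$.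
   Context: Let $S$ be a finite set of integers with $a:=\max S\ge 1$ and $b:=-\min S\ge 1$. Each $s\in S$ carries a weight $\omega_s$ in a field $K$ of characteristic $0$; set $\omega_s:=0$ for $s\in\mathbb Z\setminus S$, and for $s\in\mathbb Z$ put $\beta_s:=\delta_{s,0}-\omega_s$ and $\widetilde\beta_s:=-\beta_{s+1}$. For $k\ge0$, $A_k$ is the $(k+1)\times(k+1)$ matrix with rows and columns indexed by $0,\dots,k$ whose $(i,j)$ entry is $\omega_{j-i}$. For $0\le\ell\le k$, $F_{k,\ell}$ is the $(\ell,0)$ cofactor of $1-A_k$, i.e. $(-1)^\ell$ times the determinant of the matrix obtained from $1-A_k$ by deleting row $\ell$ and column $0$. Notation: $[m,n]:=\{i\in\mathbb Z: m\le i\le n\}$, $X+c:=\{x+c:x\in X\}$; an $n$-subset is a subset of cardinality $n$. $I_0:=[0,a-1]$, $\widetilde I_0:=[0,a-2]$ (empty if $a=1$). For a finite set $I\subseteq\mathbb Z$ and $s\in\mathbb Z$, $\epsilon_s(I):=(-1)^{\#\{i\in I:\ i<s\}}$. $\mathbf T$ is the square matrix with rows and columns indexed by the $a$-subsets of $[-b,a-1]$ and entries $\mathbf T[I,J]:=\epsilon_s(I)\beta_s$ if there is an integer $s$ with $I\cup\{a\}=(J+1)\cup\{s\}$ (such $s$ is then unique), and $0$ otherwise. $\widetilde{\mathbf T}$ is the square matrix indexed by the $(a-1)$-subsets of $[-b-1,a-2]$ with $\widetilde{\mathbf T}[I,J]:=\epsilon_s(I)\widetilde\beta_s$ if there is an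 integer $s$ with $I\cup\{a-1\}=(J+1)\cup\{s\}$, and $0$ otherwise. $\mathbf U$ is the matrix with rows indexed by the $(a-1)$-subsets of $[-b-1,a-2]$ and columns by the $a$-subsets of $[-b,a-1]$, with $\mathbf U[I,J]=1$ if $I\cup\{a-1\}=J$ and $0$ otherwise. *)

theory Defs
  imports "HOL-Computational_Algebra.Polynomial" "HOL-Computational_Algebra.Formal_Power_Series"
    "HOL-Computational_Algebra.Polynomial_FPS" "HOL-Combinatorics.Permutations"
begin

definition det_on :: "'i set \<Rightarrow> ('i \<Rightarrow> 'i \<Rightarrow> 'r::comm_ring_1) \<Rightarrow> 'r" where
  "det_on X M = (\<Sum>p \<in> {p. p permutes X}. of_int (sign p) * (\<Prod>i\<in>X. M i (p i)))"

text \<open>The (i,j) cofactor: determinant of M with row i replaced by the j-th unit row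
  (equal to (-1)^(pos i + pos j) times the (i,j) minor, for any ordering of X).\<close>
definition cofactor_on :: "'i set \<Rightarrow> ('i \<Rightarrow> 'i \<Rightarrow> 'r::comm_ring_1) \<Rightarrow> 'i \<Rightarrow> 'i \<Rightarrow> 'r" where
  "cofactor_on X M i j = det_on X (\<lambda>r c. if r = i then (if c = j then 1 else 0) else M r c)"

definition adj_on :: "'i set \<Rightarrow> ('i \<Rightarrow> 'i \<Rightarrow> 'r::comm_ring_1) \<Rightarrow> 'i \<Rightarrow> 'i \<Rightarrow> 'r" where
  "adj_on X M i j = cofactor_on X M j i"

definition beta :: "(int \<Rightarrow> 'k::field) \<Rightarrow> int \<Rightarrow> 'k" where
  "beta \<omega> s = (if s = 0 then 1 else 0) - \<omega> s"

definition betat :: "(int \<Rightarrow> 'k::field) \<Rightarrow> int \<Rightarrow> 'k" where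
  "betat \<omega> s = - beta \<omega> (s + 1)"

text \<open>A_k as a function on indices 0..k\<close>
definition Amat :: "(int \<Rightarrow> 'k::field) \<Rightarrow> nat \<Rightarrow> nat \<Rightarrow> 'k" where
  "Amat \<omega> i j = \<omega> (int j - int i)"

text \<open>F_{k,l}: (l,0) cofactor of 1 - A_k, i.e. (-1)^l times the determinant of 1 - A_k with
  row l and column 0 deleted (remaining rows/columns re-indexed increasingly by 0..k-1).\<close>
definition Fkl :: "(int \<Rightarrow> 'k::field) \<Rightarrow> nat \<Rightarrow> nat \<Rightarrow> 'k" where
  "Fkl \<omega> k l = (-1) ^ l * det_on {0..<k}
     (\<lambda>r c. let i = (if r < l then r else r + 1); j = c + 1 in
            (if i = j then 1 else 0) - Amat \<omega> i j)"

definition eps :: "int \<Rightarrow> int set \<Rightarrow> 'k::field" where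
  "eps s I = (-1) ^ card {i \<in> I. i < s}"

definition nsubsets :: "nat \<Rightarrow> int \<Rightarrow> int \<Rightarrow> int set set" where
  "nsubsets n lo hi = {I. I \<subseteq> {lo..hi} \<and> card I = n}"

definition shift1 :: "int set \<Rightarrow> int set" where
  "shift1 J = (\<lambda>x. x + 1) ` J"

definition Tmat :: "(int \<Rightarrow> 'k::field) \<Rightarrow> int \<Rightarrow> int set \<Rightarrow> int set \<Rightarrow> 'k" where
  "Tmat \<omega> a I J =
     (if \<exists>s. I \<union> {a} = shift1 J \<union> {s}
      then (let s = (THE s. I \<union> {a} = shift1 J \<union> {s}) in eps s I * beta \<omega> s)
      else 0)"

definition Ttmat :: "(int \<Rightarrow> 'k::field) \<Rightarrow> int \<Rightarrow> int set \<Rightarrow> int set \<Rightarrow> 'k" where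
  "Ttmat \<omega> a I J =
     (if \<exists>s. I \<union> {a - 1} = shift1 J \<union> {s}
      then (let s = (THE s. I \<union> {a - 1} = shift1 J \<union> {s}) in eps s I * betat \<omega> s)
      else 0)"

definition Umat :: "int \<Rightarrow> int set \<Rightarrow> int set \<Rightarrow> 'k::field" where
  "Umat a I J = (if I \<union> {a - 1} = J then 1 else 0)"

definition Idx :: "int \<Rightarrow> int \<Rightarrow> int set set" where
  "Idx a b = nsubsets (nat a) (-b) (a - 1)"

definition Idxt :: "int \<Rightarrow> int \<Rightarrow> int set set" where
  "Idxt a b = nsubsets (nat (a - 1)) (-b - 1) (a - 2)"

definition Dpoly :: "(int \<Rightarrow> 'k::field) \<Rightarrow> int \<Rightarrow> int \<Rightarrow> 'k poly" where
  "Dpoly \<omega> a b = det_on (Idx a b) (\<lambda>I J. (if I = J then 1 else 0) - [:0, Tmat \<omega> a I J:])"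

definition Dtpoly :: "(int \<Rightarrow> 'k::field) \<Rightarrow> int \<Rightarrow> int \<Rightarrow> 'k poly" where
  "Dtpoly \<omega> a b = det_on (Idxt a b) (\<lambda>I J. (if I = J then 1 else 0) - [:0, Ttmat \<omega> a I J:])"

text \<open>Bivariate polynomials K[u][z] are represented as 'k poly poly: the outer variable is z,
  the coefficients are polynomials in u.\<close>
definition zR :: "'k::comm_ring_1 poly poly" where "zR = [:0, 1:]"
definition uR :: "'k::comm_ring_1 poly poly" where "uR = [:[:0, 1:]:]"
definition cR :: "'k::comm_ring_1 \<Rightarrow> 'k poly poly" where "cR c = [:[:c:]:]"

definition Ntilde :: "(int \<Rightarrow> 'k::field) \<Rightarrow> int \<Rightarrow> int \<Rightarrow> 'k poly poly" where
  "Ntilde \<omega> a b =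
    (let M1 = adj_on (Idxt a b) (\<lambda>I J. (if I = J then 1 else 0) - uR * zR * cR (Ttmat \<omega> a I J));
         M2 = adj_on (Idx a b) (\<lambda>I J. (if I = J then 1 else 0) - zR * cR (Tmat \<omega> a I J));
         I0t = {0..a - 2}; I0 = {0..a - 1}
     in (\<Sum>J\<in>Idxt a b. \<Sum>K\<in>Idx a b. M1 I0t J * cR (Umat a J K) * M2 K I0))"

definition evalR :: "'k::comm_ring_1 poly \<Rightarrow> 'k poly poly \<Rightarrow> 'k poly poly" where
  "evalR p x = poly (map_poly cR p) x"

definition Fseries :: "(int \<Rightarrow> 'k::field) \<Rightarrow> 'k poly fps" where
  "Fseries \<omega> = Abs_fps (\<lambda>k. \<Sum>l\<le>k. monom (Fkl \<omega> k l) l)"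

end

theory Submission
  imports Defs "Jordan_Normal_Form.Determinant"
begin

text \<open>
  Expanding a minor of the banded Toeplitz matrix \<open>1 - A\<close> row by row, the only information to
  carry along is which of the columns met by the band are still unused; recording them relative to the
  current row, one row of the expansion is multiplication by the transfer matrix \<open>T\<close>. Deleting
  column 0 lowers the number of unused columns by one until the deleted row is reached, which gives
  \<open>F k l = (T~ ^ l U T ^ (k - l)) [I~0, I0]\<close> and, by summing geometric series, the generating function.

  For the degrees, one expands at \<open>z = \<infinity>\<close>. A row of \<open>T\<close> indexed by a set containing
  \<open>-b\<close>, and a column indexed by a set not containing \<open>a - 1\<close>, has a single nonzero entry,
  whose position is given by the cyclic rotation of \<open>[-b, a - 1]\<close>. Hence \<open>det T \<noteq> 0\<close>, and
  inverse powers of \<open>T\<close> applied to \<open>I0\<close> simply rotate it until it hits \<open>-b\<close>;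
  similarly for \<open>T~\<close> from the left. The matrix \<open>U\<close> kills all terms
  \<open>T~ ^ (-m) U T ^ (-n)\<close> with \<open>m < a\<close> or \<open>n \<le> b\<close>, and exactly one entry survives
  for \<open>m = a\<close>, \<open>n = b + 1\<close>.
\<close>

section \<open>Determinants over arbitrary finite index sets\<close>

lemma (in comm_ring_hom) hom_det_on: "hom (det_on X M) = det_on X (\<lambda>i j. hom (M i j))"
  by (simp add: det_on_def hom_sum hom_mult hom_prod hom_of_int)

lemma (in comm_ring_hom) hom_adj_on: "hom (adj_on X M i j) = adj_on X (\<lambda>i j. hom (M i j)) i j"
  unfolding adj_on_def cofactor_on_def hom_det_on
  by (rule arg_cong[where f = "det_on X"]) (auto simp: fun_eq_iff)

lemma det_on_cong:
  assumes "\<And>i j. i \<in> X \<Longrightarrow> j \<in> X \<Longrightarrow> M i j = N i j"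
  shows "det_on X M = det_on X N"
  unfolding det_on_def
  by (intro sum.cong refl arg_cong2[where f = "(*)"] prod.cong) (auto simp: assms permutes_in_image)

lemma det_on_transpose:
  assumes "finite X"
  shows "det_on X (\<lambda>i j. M j i) = det_on X M"
proof -
  have "det_on X M = (\<Sum>p \<in> {p. p permutes X}. of_int (sign (inv_into UNIV p)) * (\<Prod>i\<in>X. M i (inv_into UNIV p i)))"
    unfolding det_on_def
    by (rule sum.reindex_bij_witness[of _ "inv_into UNIV" "inv_into UNIV"]) (auto simp: permutes_inv permutes_inv_inv)
  also have "\<dots> = det_on X (\<lambda>i j. M j i)"
    unfolding det_on_def
  proof (rule sum.cong[OF refl])
    fix p assume "p \<in> {p. p permutes X}"
    then have p: "p permutes X" by simp
    have "(\<Prod>i\<in>X. M i (inv_into UNIV p i)) = (\<Prod>i\<in>X. M (p i) i)"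
      using prod.permute[OF p, of "\<lambda>i. M i (inv_into UNIV p i)"]
      by (simp add: o_def permutes_inverses[OF p])
    moreover have "sign (inv_into UNIV p) = sign p"
      using p assms by (meson permutation_permutes sign_inverse)
    ultimately show "of_int (sign (inv_into UNIV p)) * (\<Prod>i\<in>X. M i (inv_into UNIV p i)) = of_int (sign p) * (\<Prod>i\<in>X. M (p i) i)"
      by simp
  qed
  finally show ?thesis by simp
qed

text \<open>Replacing row \<open>i\<close> by the unit row at \<open>j\<close>, or column
  \<open>j\<close> by the unit column at \<open>i\<close>, keeps in both cases the permutations with
  \<open>p i = j\<close>, with the same products.\<close>

lemma adj_on_transpose:
  assumes X: "finite X" and "i \<in> X" "j \<in> X"
  shows "adj_on X (\<lambda>i j. M j i) i j = adj_on X M j i"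
proof -
  let ?R = "\<lambda>r c. if r = i then if c = j then 1 else 0 else M r c"
  let ?C = "\<lambda>r c. if c = j then if r = i then 1 else 0 else M r c"
  have "det_on X ?R = det_on X ?C"
    unfolding det_on_def
  proof (rule sum.cong[OF refl])
    fix p assume "p \<in> {p. p permutes X}"
    then have p: "p permutes X" by simp
    have "(\<Prod>r\<in>X. ?R r (p r)) = (\<Prod>r\<in>X. ?C r (p r))"
    proof (cases "p i = j")
      case True
      have "p r = j \<longleftrightarrow> r = i" for r
        using True permutes_inj[OF p] by (metis injD)
      with True show ?thesis by (intro prod.cong) auto
    next
      case False
      have "(\<Prod>r\<in>X. ?R r (p r)) = 0"
        using X \<open>i \<in> X\<close> False by (intro prod_zero) auto
      moreover have "(\<Prod>r\<in>X. ?C r (p r)) = 0"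
      proof (rule prod_zero[OF X])
        have "inv_into UNIV p j \<in> X" "p (inv_into UNIV p j) = j" "inv_into UNIV p j \<noteq> i"
          using p \<open>j \<in> X\<close> False by (auto simp: permutes_inverses permutes_in_image[OF permutes_inv[OF p]])
        then show "\<exists>r\<in>X. ?C r (p r) = 0" by (intro bexI[of _ "inv_into UNIV p j"]) auto
      qed
      ultimately show ?thesis by simp
    qed
    then show "of_int (sign p) * (\<Prod>r\<in>X. ?R r (p r)) = of_int (sign p) * (\<Prod>r\<in>X. ?C r (p r))"
      by simp
  qed
  then show ?thesis
    unfolding adj_on_def cofactor_on_def
    by (subst det_on_transpose[OF X, symmetric]) (auto intro: arg_cong[where f = "det_on X"])
qed

text \<open>A permutation contributes only to the cofactor at \<open>j = p i\<close>, and these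
  cofactors do not see row \<open>i\<close> of \<open>M\<close>, so any \<open>v\<close> may stand
  there.\<close>

lemma det_on_row_sum:
  assumes X: "finite X" and "i \<in> X"
  shows "(\<Sum>j\<in>X. v j * cofactor_on X M i j) = det_on X (M(i := v))"
proof -
  have split: "(\<Prod>r\<in>X. f r) = f i * (\<Prod>r\<in>X - {i}. f r)" for f :: "'a \<Rightarrow> 'b"
    using assms by (rule prod.remove)
  have "(\<Sum>j\<in>X. v j * cofactor_on X M i j) =
    (\<Sum>j\<in>X. \<Sum>p | p permutes X. (if j = p i then v j * (of_int (sign p) * (\<Prod>r\<in>X - {i}. M r (p r))) else 0))"
    unfolding cofactor_on_def det_on_def split sum_distrib_left
    by (intro sum.cong refl) (auto intro!: prod.cong)
  also have "\<dots> = (\<Sum>p | p permutes X. v (p i) * (of_int (sign p) * (\<Prod>r\<in>X - {i}. M r (p r))))"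
    using X \<open>i \<in> X\<close> by (subst sum.swap) (auto intro!: sum.cong simp: permutes_in_image)
  also have "\<dots> = det_on X (M(i := v))"
    unfolding det_on_def split
    by (intro sum.cong refl) (simp add: algebra_simps)
  finally show ?thesis .
qed

text \<open>Composition with the transposition of \<open>i\<close> and \<open>j\<close> keeps every
  product and flips every sign, so the determinant is its own negative.\<close>

lemma det_on_identical_rows:
  fixes M :: "'i \<Rightarrow> 'i \<Rightarrow> 'r::{idom, ring_char_0}"
  assumes X: "finite X" and "i \<in> X" "j \<in> X" "i \<noteq> j" and eq: "M i = M j"
  shows "det_on X M = 0"
proof -
  let ?t = "Transposition.transpose i j"
  have t: "?t permutes X" using assms by (simp add: permutes_swap_id)
  have "det_on X M = (\<Sum>p | p permutes X. of_int (sign (p \<circ> ?t)) * (\<Prod>r\<in>X. M r ((p \<circ> ?t) r)))"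
    unfolding det_on_def
    by (rule sum.reindex_bij_witness[of _ "\<lambda>p. p \<circ> ?t" "\<lambda>p. p \<circ> ?t"])
      (auto simp: comp_assoc permutes_compose[OF t])
  also have "\<dots> = (\<Sum>p | p permutes X. - (of_int (sign p) * (\<Prod>r\<in>X. M r (p r))))"
  proof (rule sum.cong[OF refl])
    fix p assume "p \<in> {p. p permutes X}"
    then have p: "p permutes X" by simp
    have "sign (p \<circ> ?t) = - sign p"
      using p t X \<open>i \<noteq> j\<close> by (subst sign_compose) (auto simp: permutation_permutes sign_swap_id)
    moreover have "M (?t r) = M r" for r
      using eq by (cases "r = i"; cases "r = j") auto
    then have "(\<Prod>r\<in>X. M r ((p \<circ> ?t) r)) = (\<Prod>r\<in>X. M r (p r))"
      using prod.permute[OF t, of "\<lambda>r. M r (p r)"] by (simp add: o_def)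
    ultimately show "of_int (sign (p \<circ> ?t)) * (\<Prod>r\<in>X. M r ((p \<circ> ?t) r)) = - (of_int (sign p) * (\<Prod>r\<in>X. M r (p r)))"
      by simp
  qed
  also have "\<dots> = - det_on X M"
    by (simp add: det_on_def sum_negf)
  finally have "2 * det_on X M = 0" by (simp add: eq_neg_iff_add_eq_0 flip: mult_2)
  then show ?thesis by simp
qed

text \<open>Off the diagonal the sum is the determinant of \<open>M\<close> with row
  \<open>k\<close> overwritten by row \<open>i\<close>, which has two equal rows.\<close>

lemma mult_adj_on:
  fixes M :: "'i \<Rightarrow> 'i \<Rightarrow> 'r::{idom, ring_char_0}"
  assumes X: "finite X" and "i \<in> X" "k \<in> X"
  shows "(\<Sum>j\<in>X. M i j * adj_on X M j k) = (if i = k then det_on X M else 0)"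
proof -
  have "(\<Sum>j\<in>X. M i j * adj_on X M j k) = det_on X (M(k := M i))"
    unfolding adj_on_def using assms by (simp add: det_on_row_sum)
  also have "\<dots> = (if i = k then det_on X M else 0)"
    using assms det_on_identical_rows[of X i k "M(k := M i)"] by (auto simp: fun_upd_idem)
  finally show ?thesis .
qed

lemma coeff_prod_linear:
  fixes f :: "'i \<Rightarrow> 'k::comm_ring_1 poly"
  assumes "finite X" and "\<And>i. i \<in> X \<Longrightarrow> degree (f i) \<le> 1"
  shows "degree (prod f X) \<le> card X \<and> coeff (prod f X) (card X) = (\<Prod>i\<in>X. coeff (f i) 1)"
  using assms
proof (induction X rule: finite_induct)
  case (insert x X)
  then have IH: "degree (prod f X) \<le> card X" "coeff (prod f X) (card X) = (\<Prod>i\<in>X. coeff (f i) 1)"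
    and fx: "degree (f x) \<le> 1" by auto
  have "f x = [:coeff (f x) 0, coeff (f x) 1:]"
    using fx by (intro poly_eqI) (auto simp: coeff_pCons coeff_eq_0 split: nat.split)
  then have "f x * prod f X = [:coeff (f x) 0, coeff (f x) 1:] * prod f X"
    by simp
  then have "coeff (f x * prod f X) (Suc (card X)) = coeff (f x) 1 * coeff (prod f X) (card X)"
    using IH by (simp add: coeff_eq_0)
  moreover have "degree (f x * prod f X) \<le> Suc (card X)"
    using degree_mult_le[of "f x" "prod f X"] IH fx by linarith
  ultimately show ?case
    using insert IH by simp
qed simp

lemma det_on_degree_le:
  fixes M :: "'i \<Rightarrow> 'i \<Rightarrow> 'k::comm_ring_1 poly"
  assumes "finite X" and "\<And>i j. i \<in> X \<Longrightarrow> degree (M i j) \<le> 1"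
  shows "degree (det_on X M) \<le> card X"
    and "coeff (det_on X M) (card X) = det_on X (\<lambda>i j. coeff (M i j) 1)"
proof -
  have deg: "degree (\<Prod>i\<in>X. M i (p i)) \<le> card X"
    and co: "coeff (\<Prod>i\<in>X. M i (p i)) (card X) = (\<Prod>i\<in>X. coeff (M i (p i)) 1)" for p
    using coeff_prod_linear[of X "\<lambda>i. M i (p i)"] assms by auto
  have s: "of_int (sign p) * q = Polynomial.smult (of_int (sign p)) q" for p :: "'i \<Rightarrow> 'i" and q :: "'k poly"
    by (simp add: of_int_poly)
  show "degree (det_on X M) \<le> card X"
    unfolding det_on_def s using assms(1)
    by (intro degree_sum_le) (auto intro!: finite_permutations order_trans[OF degree_smult_le deg])
  show "coeff (det_on X M) (card X) = det_on X (\<lambda>i j. coeff (M i j) 1)"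
    unfolding det_on_def s coeff_sum coeff_smult co ..
qed

text \<open>The constant row puts a factor 0 into every product in the coefficient at
  \<open>card X\<close>. Cofactors of \<open>1 - zT\<close> have such a row.\<close>

lemma det_on_degree_less:
  fixes M :: "'i \<Rightarrow> 'i \<Rightarrow> 'k::comm_ring_1 poly"
  assumes "finite X" and "\<And>i j. i \<in> X \<Longrightarrow> degree (M i j) \<le> 1"
    and "k \<in> X" and "\<And>j. degree (M k j) = 0"
  shows "degree (det_on X M) < card X"
proof -
  have "(\<Prod>i\<in>X. coeff (M i (p i)) 1) = 0" for p
    using assms by (intro prod_zero) (auto intro!: bexI[of _ k] coeff_eq_0)
  then have "coeff (det_on X M) (card X) = 0"
    using assms by (subst det_on_degree_le) (auto simp: det_on_def)
  moreover have "card X > 0" using assms by (auto simp: card_gt_0_iff)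
  ultimately show ?thesis
    using det_on_degree_le(1)[of X M] assms
    by (metis le_neq_implies_less leading_coeff_0_iff degree_0)
qed

section \<open>Coefficients of the adjugate of $1 - zT$\<close>

definition id_minus_z :: "('i \<Rightarrow> 'i \<Rightarrow> 'k::comm_ring_1) \<Rightarrow> 'i \<Rightarrow> 'i \<Rightarrow> 'k poly" where
  "id_minus_z T i j = (if i = j then 1 else 0) - [:0, T i j:]"

lemma degree_id_minus_z: "degree (id_minus_z T i j) \<le> 1"
  unfolding id_minus_z_def by (rule degree_diff_le) (auto simp: degree_pCons_eq_if)

lemma id_minus_z_transpose: "id_minus_z (\<lambda>i j. T j i) = (\<lambda>i j. id_minus_z T j i)"
  by (auto simp: id_minus_z_def fun_eq_iff)

lemma det_id_minus_z:
  fixes T :: "'i \<Rightarrow> 'i \<Rightarrow> 'k::field"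
  assumes "finite X" and "det_on X T \<noteq> 0"
  shows "degree (det_on X (id_minus_z T)) = card X"
proof -
  have "coeff (det_on X (id_minus_z T)) (card X) = det_on X (\<lambda>i j. - T i j)"
    unfolding det_on_degree_le(2)[OF assms(1) degree_id_minus_z]
    by (rule det_on_cong) (simp add: id_minus_z_def)
  also have "\<dots> = (-1) ^ card X * det_on X T"
    by (simp add: det_on_def prod_uminus sum_distrib_left mult.left_commute)
  also have "\<dots> \<noteq> 0" using assms by simp
  finally have "card X \<le> degree (det_on X (id_minus_z T))" by (rule le_degree)
  moreover have "degree (det_on X (id_minus_z T)) \<le> card X"
    by (intro det_on_degree_le assms(1) degree_id_minus_z)
  ultimately show ?thesis by simp
qed

lemma degree_adj_id_minus_z:
  assumes "finite X" and "k \<in> X"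
  shows "degree (adj_on X (id_minus_z T) i k) < card X"
  unfolding adj_on_def cofactor_on_def
  using assms degree_id_minus_z by (intro det_on_degree_less) auto

text \<open>Comparison of coefficients in \<open>(1 - zT) adj(1 - zT) = det(1 - zT)\<close>. The
  recurrence serves both the expansion at 0 and the one at infinity.\<close>

lemma coeff_adj_id_minus_z:
  fixes T :: "'i \<Rightarrow> 'i \<Rightarrow> 'k::field_char_0"
  assumes "finite X" and "i \<in> X" "k \<in> X"
  shows "coeff (adj_on X (id_minus_z T) i k) 0 = (if i = k then coeff (det_on X (id_minus_z T)) 0 else 0)"
    and "coeff (adj_on X (id_minus_z T) i k) (Suc n) =
      (if i = k then coeff (det_on X (id_minus_z T)) (Suc n) else 0)
        + (\<Sum>j\<in>X. T i j * coeff (adj_on X (id_minus_z T) j k) n)"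
proof -
  define x where "x j = adj_on X (id_minus_z T) j k" for j
  have "(if i = k then det_on X (id_minus_z T) else 0) = (\<Sum>j\<in>X. id_minus_z T i j * x j)"
    unfolding x_def using assms by (simp add: mult_adj_on)
  also have "\<dots> = (\<Sum>j\<in>X. (if i = j then x j else 0) - pCons 0 (Polynomial.smult (T i j) (x j)))"
    by (intro sum.cong) (auto simp: id_minus_z_def algebra_simps)
  also have "\<dots> = x i - (\<Sum>j\<in>X. pCons 0 (Polynomial.smult (T i j) (x j)))"
    using assms by (simp add: sum_subtractf)
  finally have *: "x i = (if i = k then det_on X (id_minus_z T) else 0)
      + (\<Sum>j\<in>X. pCons 0 (Polynomial.smult (T i j) (x j)))"
    by simp
  show "coeff (adj_on X (id_minus_z T) i k) 0 = (if i = k then coeff (det_on X (id_minus_z T)) 0 else 0)"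
    using arg_cong[OF *, of "\<lambda>p. coeff p 0"] by (simp add: x_def coeff_sum)
  show "coeff (adj_on X (id_minus_z T) i k) (Suc n) =
      (if i = k then coeff (det_on X (id_minus_z T)) (Suc n) else 0)
        + (\<Sum>j\<in>X. T i j * coeff (adj_on X (id_minus_z T) j k) n)"
    using arg_cong[OF *, of "\<lambda>p. coeff p (Suc n)"] by (simp add: x_def coeff_sum)
qed

text \<open>The entry \<open>(i, k)\<close> of the \<open>n\<close>-th power of \<open>T\<close>.
  Applied to the transposed matrix it yields rows of the power.\<close>

primrec pow_column :: "'i set \<Rightarrow> ('i \<Rightarrow> 'i \<Rightarrow> 'k::comm_ring_1) \<Rightarrow> 'i \<Rightarrow> nat \<Rightarrow> 'i \<Rightarrow> 'k" where
  "pow_column X T k 0 i = (if i = k then 1 else 0)"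
| "pow_column X T k (Suc n) i = (\<Sum>j\<in>X. T i j * pow_column X T k n j)"

text \<open>The geometric series for the inverse of \<open>1 - zT\<close>, multiplied by the
  determinant: both sides obey the same recurrence in the degree.\<close>

lemma adj_id_minus_z_eq:
  fixes T :: "'i \<Rightarrow> 'i \<Rightarrow> 'k::field_char_0"
  assumes "finite X" and "i \<in> X" "k \<in> X"
  shows "fps_of_poly (adj_on X (id_minus_z T) i k) =
    fps_of_poly (det_on X (id_minus_z T)) * Abs_fps (\<lambda>n. pow_column X T k n i)"
proof (rule fps_ext)
  fix n
  let ?d = "coeff (det_on X (id_minus_z T))"
  have "coeff (adj_on X (id_minus_z T) i k) n = (\<Sum>m\<le>n. ?d m * pow_column X T k (n - m) i)"
    using \<open>i \<in> X\<close>
  proof (induction n arbitrary: i)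
    case 0
    then show ?case using assms by (simp add: coeff_adj_id_minus_z)
  next
    case (Suc n)
    have "(\<Sum>j\<in>X. T i j * coeff (adj_on X (id_minus_z T) j k) n)
        = (\<Sum>j\<in>X. \<Sum>m\<le>n. ?d m * (T i j * pow_column X T k (n - m) j))"
      by (intro sum.cong refl) (simp add: Suc.IH sum_distrib_left mult_ac)
    also have "\<dots> = (\<Sum>m\<le>n. ?d m * pow_column X T k (Suc n - m) i)"
      by (subst sum.swap) (simp add: sum_distrib_left Suc_diff_le)
    finally show ?case
      using Suc.prems assms by (simp add: coeff_adj_id_minus_z)
  qed
  then show "fps_nth (fps_of_poly (adj_on X (id_minus_z T) i k)) n =
      fps_nth (fps_of_poly (det_on X (id_minus_z T)) * Abs_fps (\<lambda>n. pow_column X T k n i)) n"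
    by (simp add: fps_mult_nth atLeast0AtMost)
qed

text \<open>
  Here \<open>x\<close> is a column of the adjugate of \<open>1 - zT\<close> and \<open>d\<close> its determinant, so that formally
  \<open>x\<close> is read from the top degree down by applying powers of the inverse of \<open>T\<close> to the basis vector
  \<open>s 0\<close>. The rows in \<open>P\<close> and the columns outside \<open>\<phi> ` P\<close> are monomial, which makes this
  inverse act as \<open>\<phi>\<close> along \<open>s 0, \<dots>, s b\<close>.
\<close>
lemma top_coeffs_of_recurrence:
  fixes T :: "'i \<Rightarrow> 'i \<Rightarrow> 'k::field" and x :: "'i \<Rightarrow> nat \<Rightarrow> 'k" and d :: "nat \<Rightarrow> 'k"
  assumes X: "finite X" and \<phi>: "bij_betw \<phi> X X" and P: "P \<subseteq> X"
    and row: "\<And>I J. I \<in> P \<Longrightarrow> J \<in> X \<Longrightarrow> T I J \<noteq> 0 \<longleftrightarrow> J = \<phi> I"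
    and col: "\<And>I J. I \<in> X \<Longrightarrow> J \<in> X \<Longrightarrow> J \<notin> \<phi> ` P \<Longrightarrow> T I J \<noteq> 0 \<longleftrightarrow> J = \<phi> I"
    and x0: "\<And>I. I \<in> X \<Longrightarrow> x I 0 = (if I = s 0 then d 0 else 0)"
    and xSuc: "\<And>I m. I \<in> X \<Longrightarrow> x I (Suc m) = (if I = s 0 then d (Suc m) else 0) + (\<Sum>J\<in>X. T I J * x J m)"
    and deg: "\<And>I m. I \<in> X \<Longrightarrow> m \<ge> N \<Longrightarrow> x I m = 0"
    and dN: "d N \<noteq> 0"
    and sX: "s 0 \<in> X" and sSuc: "\<And>i. i < b \<Longrightarrow> s (Suc i) = \<phi> (s i)"
    and sP: "\<And>i. i < b \<Longrightarrow> s i \<notin> P" "s b \<in> P"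
  shows "b < N" and "\<And>J m. J \<in> \<phi> ` P \<Longrightarrow> N - b \<le> m \<Longrightarrow> x J m = 0"
    and "\<And>J. J \<in> \<phi> ` P \<Longrightarrow> x J (N - Suc b) \<noteq> 0 \<longleftrightarrow> J = \<phi> (s b)"
proof -
  \<comment> \<open>\<open>y\<close> at degree \<open>m + 1\<close> is \<open>T\<close> applied to
    the coefficients of \<open>x\<close> at degree \<open>m\<close>; at degree \<open>N\<close> it
    is \<open>- d N\<close> at \<open>s 0\<close> and 0 elsewhere.\<close>
  define y where "y I m = x I m - (if I = s 0 then d m else 0)" for I m
  have ySuc: "y I (Suc m) = (\<Sum>J\<in>X. T I J * x J m)" if "I \<in> X" for I m
    using that by (simp add: y_def xSuc)
  have sin: "s i \<in> X" if "i \<le> b" for i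
    using that by (induction i) (use sX sSuc \<phi> in \<open>auto simp: bij_betw_def\<close>)
  have \<phi>X: "\<phi> I \<in> X" if "I \<in> X" for I using that \<phi> by (auto simp: bij_betw_def)
  have inj: "\<phi> I = \<phi> J \<longleftrightarrow> I = J" if "I \<in> X" "J \<in> X" for I J
    using that \<phi> by (auto simp: bij_betw_def inj_on_def)
  have single: "y I (Suc m) = T I (\<phi> I) * x (\<phi> I) m"
    if I: "I \<in> X" and z: "\<And>J. J \<in> X \<Longrightarrow> J \<noteq> \<phi> I \<Longrightarrow> T I J = 0 \<or> x J m = 0" for I m
  proof -
    have "y I (Suc m) = (\<Sum>J\<in>{\<phi> I}. T I J * x J m)"
      unfolding ySuc[OF I] by (rule sum.mono_neutral_right) (use X \<phi>X[OF I] z in auto)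
    then show ?thesis by simp
  qed
  have onP: "x (\<phi> I) m \<noteq> 0 \<longleftrightarrow> y I (Suc m) \<noteq> 0" if "I \<in> P" for I m
  proof -
    have "I \<in> X" using that P by auto
    then show ?thesis using row[OF that] single[of I m] \<phi>X[of I] by (metis mult_eq_0_iff)
  qed
  \<comment> \<open>Once \<open>y\<close> vanishes on \<open>P\<close>, the columns in the image of
    \<open>P\<close> meet only zeros of \<open>x\<close>; each other column has a single
    entry.\<close>
  have offP: "x (\<phi> I) m \<noteq> 0 \<longleftrightarrow> y I (Suc m) \<noteq> 0"
    if "I \<in> X" "I \<notin> P" and z: "\<And>I. I \<in> P \<Longrightarrow> y I (Suc m) = 0" for I m
  proof -
    have z': "x J m = 0" if "J \<in> \<phi> ` P" for J using that onP z by blast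
    have "\<phi> I \<notin> \<phi> ` P" using that inj P by blast
    then have "T I (\<phi> I) \<noteq> 0" using col \<open>I \<in> X\<close> \<phi>X by blast
    moreover have "T I J = 0 \<or> x J m = 0" if "J \<in> X" "J \<noteq> \<phi> I" for J
      using col[OF \<open>I \<in> X\<close> \<open>J \<in> X\<close>] z' that by blast
    ultimately show ?thesis using single[OF \<open>I \<in> X\<close>, of m] by auto
  qed
  \<comment> \<open>Going down from degree \<open>N\<close>, the support of \<open>y\<close> after
    \<open>n\<close> steps contains \<open>s n\<close> and lies within \<open>s 0, ..., s n\<close>,
    which avoid \<open>P\<close> until \<open>s b\<close> is reached.\<close>
  have Q: "n < N \<and> y (s n) (N - n) \<noteq> 0 \<and> (\<forall>I\<in>X. y I (N - n) \<noteq> 0 \<longrightarrow> I \<in> s ` {..n})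
      \<and> (\<forall>J\<in>\<phi> ` P. \<forall>m\<ge>N - n. x J m = 0)" if "n \<le> b" for n
    using that
  proof (induction n)
    case 0
    have "N \<noteq> 0" using x0[OF sX] deg[OF sX, of 0] dN by (cases N) auto
    then show ?case
      using deg dN sX P \<phi>X by (auto simp: y_def)
  next
    case (Suc n)
    then have IH: "n < N" "y (s n) (N - n) \<noteq> 0" "\<And>I. I \<in> X \<Longrightarrow> y I (N - n) \<noteq> 0 \<Longrightarrow> I \<in> s ` {..n}"
      "\<And>J m. J \<in> \<phi> ` P \<Longrightarrow> m \<ge> N - n \<Longrightarrow> x J m = 0" by auto
    define m where "m = N - Suc n"
    have m: "N - n = Suc m" using IH(1) by (simp add: m_def)
    have yP: "y I (Suc m) = 0" if "I \<in> P" for I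
      using IH(3)[of I] that P sP(1) Suc.prems m by (metis (no_types, lifting) Suc_le_lessD atMost_iff imageE le_less_trans subsetD)
    have new: "x (\<phi> I) m \<noteq> 0 \<longleftrightarrow> y I (Suc m) \<noteq> 0" if "I \<in> X" for I
      using that onP offP yP by blast
    have xs: "x (s (Suc n)) m \<noteq> 0"
      using new[OF sin, of n] IH(2) sSuc Suc.prems m by simp
    have supp: "J \<in> s ` {..Suc n}" if J: "J \<in> X" and "x J m \<noteq> 0" for J
    proof -
      obtain I where I: "I \<in> X" "J = \<phi> I" using J \<phi> by (auto simp: bij_betw_def)
      then have "I \<in> s ` {..n}" using new that IH(3) m by auto
      then obtain i where "i \<le> n" "I = s i" by auto
      then have "J = s (Suc i)" using I sSuc Suc.prems by simp
      then show ?thesis using \<open>i \<le> n\<close> by auto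
    qed
    \<comment> \<open>Had the orbit returned to \<open>s 0\<close> by step \<open>b\<close>, then
      \<open>s b\<close>, which is in \<open>P\<close>, would equal an earlier state, which is
      not.\<close>
    have s0: "s (Suc n) \<noteq> s 0"
    proof
      assume eq: "s (Suc n) = s 0"
      have "s (Suc n + i) = s i" if "Suc n + i \<le> b" for i
        using that by (induction i) (simp_all add: eq sSuc)
      from this[of "b - Suc n"] have "s (b - Suc n) = s b" using Suc.prems by simp
      then show False using sP Suc.prems by (metis diff_less le_less_trans not_less_eq_eq zero_less_Suc le0 less_le_trans)
    qed
    have ys: "y (s (Suc n)) m \<noteq> 0" using xs s0 by (simp add: y_def)
    have "m \<noteq> 0"
    proof
      assume "m = 0"
      then show False using xs x0[OF sin[OF Suc.prems]] s0 by auto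
    qed
    moreover have "J \<in> s ` {..Suc n}" if "J \<in> X" "y J m \<noteq> 0" for J
      using supp[OF that(1)] that(2) by (cases "J = s 0") (auto simp: y_def)
    moreover have "x J k = 0" if "J \<in> \<phi> ` P" "k \<ge> m" for J k
    proof (cases "k = m")
      case True
      then show ?thesis using that onP yP by auto
    next
      case False
      then show ?thesis using IH(4)[OF that(1), of k] that(2) m by auto
    qed
    ultimately show ?case using ys by (auto simp: m_def)
  qed
  show "b < N" using Q[of b] by simp
  show "x J m = 0" if "J \<in> \<phi> ` P" "N - b \<le> m" for J m using Q[of b] that by blast
  fix J assume "J \<in> \<phi> ` P"
  then obtain I where I: "I \<in> P" "J = \<phi> I" by auto
  have Nb: "N - b = Suc (N - Suc b)" using Q[of b] by (intro Suc_diff_Suc[symmetric]) blast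
  have "x J (N - Suc b) \<noteq> 0 \<longleftrightarrow> y I (N - b) \<noteq> 0" using onP[OF I(1)] I(2) Nb by simp
  also have "\<dots> \<longleftrightarrow> I = s b"
  proof
    assume "y I (N - b) \<noteq> 0"
    then obtain i where "i \<le> b" "I = s i" using Q[of b] I P by auto
    then show "I = s b" using sP(1)[of i] I by (cases "i = b") auto
  qed (use Q[of b] in auto)
  also have "\<dots> \<longleftrightarrow> J = \<phi> (s b)" using inj[of I "s b"] I P sP by auto
  finally show "x J (N - Suc b) \<noteq> 0 \<longleftrightarrow> J = \<phi> (s b)" .
qed

section \<open>Substitution of \<open>z\<close> and \<open>uz\<close> into polynomials in one
  variable\<close>

lemma evalR_pCons: "evalR (pCons c p) x = cR c + x * evalR p x"
  unfolding evalR_def by (subst map_poly_pCons) (auto simp: cR_def)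

lemma evalR_hom: "comm_ring_hom (\<lambda>p :: 'k::comm_ring_1 poly. evalR p x)"
proof -
  have 0: "evalR 0 x = 0" by (simp add: evalR_def)
  have add: "evalR (p + q) x = evalR p x + evalR q x" for p q :: "'k poly"
    by (induction p q rule: poly_induct2) (simp_all add: 0 evalR_pCons cR_def algebra_simps)
  have smult: "evalR (Polynomial.smult c p) x = cR c * evalR p x" for c and p :: "'k poly"
    by (induction p) (simp_all add: 0 evalR_pCons cR_def algebra_simps)
  have "evalR (p * q) x = evalR p x * evalR q x" for p q :: "'k poly"
    by (induction p) (simp_all add: 0 add smult evalR_pCons, simp_all add: cR_def algebra_simps)
  moreover have "evalR 1 x = 1"
    by (simp add: one_pCons evalR_pCons 0) (simp add: cR_def)
  ultimately show ?thesis by unfold_locales (auto simp: 0 add)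
qed

lemma coeff_evalR_zR: "coeff (evalR p zR) n = [:coeff p n:]"
proof (induction p arbitrary: n)
  case 0
  then show ?case by (simp add: evalR_def)
next
  case (pCons c p)
  then show ?case by (cases n) (auto simp: evalR_pCons zR_def cR_def)
qed

lemma coeff_evalR_uR_zR: "coeff (evalR p (uR * zR)) n = monom (coeff p n) n"
proof (induction p arbitrary: n)
  case 0
  then show ?case by (simp add: evalR_def)
next
  case (pCons c p)
  then show ?case
    by (cases n) (auto simp: evalR_pCons zR_def uR_def cR_def monom_Suc monom_0)
qed

text \<open>A permutation avoiding zero entries follows \<open>\<phi>\<close> on \<open>P\<close>
  because of the rows. The other rows are left with columns outside the image of \<open>P\<close>,
  which force \<open>\<phi>\<close> again, so one Leibniz term survives.\<close>

lemma det_on_ne_0_of_unique_permutation: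
  fixes T :: "'i \<Rightarrow> 'i \<Rightarrow> 'k::idom"
  assumes X: "finite X" and \<phi>: "bij_betw \<phi> X X" and P: "P \<subseteq> X"
    and row: "\<And>I J. I \<in> P \<Longrightarrow> J \<in> X \<Longrightarrow> T I J \<noteq> 0 \<longleftrightarrow> J = \<phi> I"
    and col: "\<And>I J. I \<in> X \<Longrightarrow> J \<in> X \<Longrightarrow> J \<notin> \<phi> ` P \<Longrightarrow> T I J \<noteq> 0 \<longleftrightarrow> J = \<phi> I"
  shows "det_on X T \<noteq> 0"
proof -
  define q where "q I = (if I \<in> X then \<phi> I else I)" for I
  have q: "q permutes X"
    using \<phi> by (intro bij_imp_permutes) (auto simp: q_def cong: bij_betw_cong)
  have qX: "q I \<in> X" if "I \<in> X" for I using that q by (simp add: permutes_in_image)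
  have qP: "q ` P = \<phi> ` P" using P by (auto simp: q_def image_iff)
  have nz: "T I (q I) \<noteq> 0" if I: "I \<in> X" for I
  proof (cases "I \<in> P")
    case True
    then show ?thesis using row qX[OF I] I by (simp add: q_def)
  next
    case False
    then have "q I \<notin> \<phi> ` P" unfolding qP[symmetric] using permutes_inj[OF q] by (auto dest: injD)
    then show ?thesis using col[OF I qX[OF I]] I by (simp add: q_def)
  qed
  have "p = q" if p: "p permutes X" and prod: "\<And>I. I \<in> X \<Longrightarrow> T I (p I) \<noteq> 0" for p
  proof
    fix I
    have onP: "p I = \<phi> I" if "I \<in> P" for I
      using row[OF that] prod[of I] that P p by (auto simp: permutes_in_image)
    show "p I = q I"
    proof (cases "I \<in> X")
      case I: True
      have "p I = \<phi> I"
      proof (cases "I \<in> P")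
        case False
        have "p I \<notin> \<phi> ` P"
        proof
          assume "p I \<in> \<phi> ` P"
          then obtain I' where "I' \<in> P" "p I = p I'" using onP by auto
          then show False using permutes_inj[OF p] False by (auto dest: injD)
        qed
        then show ?thesis using col[OF I] prod[OF I] p I by (auto simp: permutes_in_image)
      qed (rule onP)
      then show ?thesis using I by (simp add: q_def)
    next
      case False
      then show ?thesis using p by (simp add: q_def permutes_not_in)
    qed
  qed
  then have "det_on X T = (\<Sum>p\<in>{q}. of_int (sign p) * (\<Prod>I\<in>X. T I (p I)))"
    unfolding det_on_def using X q
    by (intro sum.mono_neutral_right) (auto simp: finite_permutations)
  also have "\<dots> \<noteq> 0"
    using nz X by (auto simp: sign_def)
  finally show ?thesis .
qed

section \<open>Minors of banded Toeplitz matrices\<close>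

abbreviation dec :: "int set \<Rightarrow> int set" where
  "dec C \<equiv> (\<lambda>x. x - 1) ` C"

lemma mem_dec: "x \<in> dec C \<longleftrightarrow> x + 1 \<in> C"
  by (auto simp: image_iff intro!: bexI[of _ "x + 1"])

lemma card_dec: "card (dec C) = card C"
  by (rule card_image) (auto simp: inj_on_def)

text \<open>
  Iterated Laplace expansion along the first row. Column labels are relative to the current row, hence
  the shift after each row: row \<open>i\<close> has entry \<open>(rs ! i) (c - i)\<close> in the absolute column \<open>c\<close>.
\<close>
primrec minor :: "(int \<Rightarrow> 'k::field) list \<Rightarrow> int set \<Rightarrow> 'k" where
  "minor [] C = (if C = {} then 1 else 0)"
| "minor (r # rs) C = (\<Sum>s\<in>C. eps s C * r s * minor rs (dec (C - {s})))"

lemma minor_eq_0_of_card: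
  "finite C \<Longrightarrow> card C \<noteq> length rs \<Longrightarrow> minor rs C = 0"
proof (induction rs arbitrary: C)
  case (Cons r rs)
  have "minor rs (dec (C - {s})) = 0" if "s \<in> C" for s
    using Cons.prems card_Suc_Diff1[OF Cons.prems(1) that] by (intro Cons.IH) (auto simp: card_dec)
  then show ?case by simp
qed auto

text \<open>A column left of all bands only moves further left from row to row, so no nonzero entry
  ever uses it.\<close>

lemma minor_eq_0_of_column:
  "finite C \<Longrightarrow> c \<in> C \<Longrightarrow> (\<And>r t. r \<in> set rs \<Longrightarrow> t \<le> c \<Longrightarrow> r t = 0) \<Longrightarrow> minor rs C = 0"
proof (induction rs arbitrary: C c)
  case (Cons r rs)
  have "r s * minor rs (dec (C - {s})) = 0" if "s \<in> C" for s
  proof (cases "s = c")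
    case False
    have "minor rs (dec (C - {s})) = 0"
      by (rule Cons.IH[of _ "c - 1"]) (use Cons.prems False in auto)
    then show ?thesis by simp
  qed (use Cons.prems in auto)
  then show ?case by (auto simp: mult.assoc intro!: sum.neutral)
qed auto

lemma sorted_less_nth:
  assumes "sorted_wrt (<) (cs :: int list)" "i < length cs" "j < length cs"
  shows "cs ! i < cs ! j \<longleftrightarrow> i < j"
  using assms sorted_wrt_nth_less[of "(<)" cs i j] sorted_wrt_nth_less[of "(<)" cs j i]
  by (metis less_asym less_linear)

text \<open>Laplace expansion with columns named by labels: exactly \<open>j\<close> labels lie
  below \<open>cs ! j\<close>, so the sign \<open>(-1)^j\<close> is \<open>eps\<close>.\<close>

lemma det_eq_minor:
  fixes rs :: "(int \<Rightarrow> 'k::field) list"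
  assumes "sorted_wrt (<) cs" and "length rs = length cs"
  shows "det_on {0..<length cs} (\<lambda>i j. (rs ! i) (cs ! j - int i)) = minor rs (set cs)"
proof -
  have "Determinant.det (mat (length cs) (length cs) (\<lambda>(i, j). (rs ! i) (cs ! j - int i))) = minor rs (set cs)"
    using assms
  proof (induction rs arbitrary: cs)
    case (Cons r rs)
    let ?n = "length cs"
    let ?A = "mat ?n ?n (\<lambda>(i, j). ((r # rs) ! i) (cs ! j - int i))"
    have n: "?n = Suc (length rs)" using Cons.prems by simp
    have step: "cofactor ?A 0 j = eps (cs ! j) (set cs) * minor rs (dec (set cs - {cs ! j}))" if j: "j < ?n" for j
    proof -
      define cs' where "cs' = map (\<lambda>x. x - 1) (take j cs @ drop (Suc j) cs)"
      have len: "length cs' = length rs" using j n by (simp add: cs'_def)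
      have dist: "distinct cs" using Cons.prems strict_sorted_iff by blast
      have split: "cs = take j cs @ cs ! j # drop (Suc j) cs" using j by (simp add: id_take_nth_drop)
      have "sorted_wrt (<) (take j cs @ cs ! j # drop (Suc j) cs)"
        using Cons.prems(1) split by metis
      then have s': "sorted_wrt (<) cs'"
        unfolding cs'_def sorted_wrt_map sorted_wrt_append by fastforce
      have "set cs - {cs ! j} = set (take j cs @ drop (Suc j) cs)"
        using dist by (subst (asm) split, subst split) (auto simp del: append_take_drop_id)
      then have set': "set cs' = dec (set cs - {cs ! j})"
        by (simp add: cs'_def image_Un)
      have nth': "cs' ! i = cs ! (if i < j then i else Suc i) - 1" if "i < length rs" for i
        using that j n by (auto simp: cs'_def nth_append)
      have "mat_delete ?A 0 j = mat (length cs') (length cs') (\<lambda>(i, j). (rs ! i) (cs' ! j - int i))"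
        unfolding mat_delete_def using j n len by (intro eq_matI) (auto simp: nth' algebra_simps)
      then have "Determinant.det (mat_delete ?A 0 j) = minor rs (dec (set cs - {cs ! j}))"
        using Cons.IH[OF s'] len set' by simp
      moreover have below: "{c \<in> set cs. c < cs ! j} = (\<lambda>i. cs ! i) ` {..<j}"
      proof (intro equalityI subsetI)
        fix c assume "c \<in> {c \<in> set cs. c < cs ! j}"
        then obtain i where "i < ?n" "c = cs ! i" "cs ! i < cs ! j" by (auto simp: in_set_conv_nth)
        then show "c \<in> (\<lambda>i. cs ! i) ` {..<j}" using sorted_less_nth[OF Cons.prems(1), of i j] j by auto
      next
        fix c assume "c \<in> (\<lambda>i. cs ! i) ` {..<j}"
        then show "c \<in> {c \<in> set cs. c < cs ! j}"
          using sorted_less_nth[OF Cons.prems(1)] j by auto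
      qed
      then have "card {c \<in> set cs. c < cs ! j} = j"
        unfolding below using dist j by (subst card_image) (auto simp: inj_on_def nth_eq_iff_index_eq)
      ultimately show ?thesis by (simp add: cofactor_def eps_def)
    qed
    have "Determinant.det ?A = (\<Sum>j<?n. ?A $$ (0, j) * cofactor ?A 0 j)"
      by (rule laplace_expansion_row) (use n in auto)
    also have "\<dots> = (\<Sum>j<?n. eps (cs ! j) (set cs) * r (cs ! j) * minor rs (dec (set cs - {cs ! j})))"
    proof (rule sum.cong[OF refl])
      fix j assume "j \<in> {..<?n}"
      then have j: "j < ?n" by simp
      have "?A $$ (0, j) = r (cs ! j)" using j n by simp
      then show "?A $$ (0, j) * cofactor ?A 0 j
          = eps (cs ! j) (set cs) * r (cs ! j) * minor rs (dec (set cs - {cs ! j}))"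
        unfolding step[OF j] by (simp only: mult_ac)
    qed
    also have "\<dots> = minor (r # rs) (set cs)"
      using Cons.prems(1) strict_sorted_iff
      by (simp, intro sum.reindex_bij_betw bij_betw_nth) auto
    finally show ?case .
  qed simp
  \<comment> \<open>The expansion was done for \<open>Determinant.det\<close>; on
    \<open>{0..<n}\<close> it is the same Leibniz sum as \<open>det_on\<close>.\<close>
  moreover have "Determinant.det (mat n n (\<lambda>(i, j). M i j)) = det_on {0..<n} M" for n and M :: "nat \<Rightarrow> nat \<Rightarrow> 'k"
    unfolding Determinant.det_def det_on_def
    by (auto intro!: sum.cong arg_cong2[where f = "(*)"] prod.cong simp: permutes_in_image)
  ultimately show ?thesis by simp
qed

section \<open>Transfer matrices\<close>

text \<open>The pairs \<open>(a, b)\<close> and \<open>(a - 1, b + 1)\<close> for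
  \<open>(\<alpha>, lo)\<close> give the two index sets; \<open>transfer\<close> likewise covers
  both matrices.\<close>

definition states :: "int \<Rightarrow> int \<Rightarrow> int set set" where
  "states \<alpha> lo = nsubsets (nat \<alpha>) (- lo) (\<alpha> - 1)"

definition transfer :: "(int \<Rightarrow> 'k::field) \<Rightarrow> int \<Rightarrow> int set \<Rightarrow> int set \<Rightarrow> 'k" where
  "transfer \<gamma> \<alpha> I J =
     (if \<exists>s. I \<union> {\<alpha>} = shift1 J \<union> {s}
      then (let s = (THE s. I \<union> {\<alpha>} = shift1 J \<union> {s}) in eps s I * \<gamma> s)
      else 0)"

text \<open>
  The columns not yet used when \<open>n\<close> rows remain: \<open>I\<close> lists those already met by the band, and
  the columns beyond the right end of the matrix are cut off.
\<close>
definition free_cols :: "int \<Rightarrow> nat \<Rightarrow> int set \<Rightarrow> int set" where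
  "free_cols \<alpha> n I = {c \<in> I \<union> {\<alpha>..}. c < int n}"

abbreviation succ_state :: "int \<Rightarrow> int set \<Rightarrow> int \<Rightarrow> int set" where
  "succ_state \<alpha> I s \<equiv> dec (insert \<alpha> I - {s})"

text \<open>The case \<open>\<alpha> = 0\<close> is included because for \<open>a = 1\<close> the
  second matrix has the empty set as its only state.\<close>

locale band =
  fixes \<gamma> :: "int \<Rightarrow> 'k::field_char_0" and \<alpha> lo :: int
  assumes \<alpha>: "\<alpha> \<ge> 0" and lo: "lo \<ge> 1"
    and band: "s < - lo \<or> \<alpha> < s \<Longrightarrow> \<gamma> s = 0"
    and top: "\<gamma> \<alpha> \<noteq> 0" and bot: "\<gamma> (- lo) \<noteq> 0"
begin

abbreviation "X \<equiv> states \<alpha> lo"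
abbreviation "T \<equiv> transfer \<gamma> \<alpha>"

lemma X_iff: "I \<in> X \<longleftrightarrow> I \<subseteq> {-lo..\<alpha>-1} \<and> card I = nat \<alpha>"
  by (simp add: states_def nsubsets_def)

lemma finite_X: "finite X"
  by (rule finite_subset[of _ "Pow {-lo..\<alpha>-1}"]) (unfold states_def nsubsets_def, blast, simp)

lemma X_D:
  assumes "I \<in> X"
  shows "finite I" "card I = nat \<alpha>" "\<alpha> \<notin> I" "\<And>i. i \<in> I \<Longrightarrow> - lo \<le> i \<and> i < \<alpha>"
  using assms finite_subset[of I "{-lo..\<alpha>-1}"] by (auto simp: X_iff)

lemma card_X: "card X = nat (\<alpha> + lo) choose nat \<alpha>"
  unfolding states_def nsubsets_def by (subst n_subsets) (auto simp: algebra_simps)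

text \<open>A free column at \<open>- lo\<close> would leave the band after this row, so it has to
  be the one used now.\<close>

lemma succ_state_in_X:
  assumes I: "I \<in> X" and s: "s \<in> insert \<alpha> I" and "- lo \<in> I \<Longrightarrow> s = - lo"
  shows "succ_state \<alpha> I s \<in> X"
proof -
  have "card (succ_state \<alpha> I s) = nat \<alpha>"
    using X_D[OF I] s by (simp add: card_dec)
  moreover have "x \<in> {-lo..\<alpha>-1}" if "x \<in> succ_state \<alpha> I s" for x
  proof -
    have x: "x + 1 \<in> insert \<alpha> I" "x + 1 \<noteq> s" using that by (auto simp: mem_dec)
    then have "x + 1 \<noteq> - lo" using assms(3) \<alpha> lo by auto
    moreover have "- lo \<le> x + 1" "x + 1 \<le> \<alpha>" using x X_D(4)[OF I] \<alpha> lo by fastforce+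
    ultimately show ?thesis by simp
  qed
  ultimately show ?thesis unfolding X_iff by blast
qed

lemma inj_succ_state: "inj_on (succ_state \<alpha> I) (insert \<alpha> I)"
proof (rule inj_onI)
  fix s t assume s: "s \<in> insert \<alpha> I" and eq: "succ_state \<alpha> I s = succ_state \<alpha> I t"
  have "s - 1 \<notin> succ_state \<alpha> I s" by (simp add: mem_dec)
  then have "s - 1 \<notin> succ_state \<alpha> I t" using eq by simp
  then show "s = t" using s by (auto simp: mem_dec)
qed

lemma shift1_dec: "shift1 (dec C) = C"
  by (simp add: shift1_def image_image)

lemma dec_shift1: "dec (shift1 C) = C"
  by (simp add: shift1_def image_image)

lemma transfer_succ_state:
  assumes I: "I \<in> X" and s: "s \<in> insert \<alpha> I"
  shows "T I (succ_state \<alpha> I s) = eps s I * \<gamma> s"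
proof -
  have "I \<union> {\<alpha>} = (insert \<alpha> I - {s}) \<union> {t} \<longleftrightarrow> t = s" for t using s by auto
  then show ?thesis by (simp add: transfer_def shift1_dec)
qed

lemma transfer_nonzeroD:
  assumes I: "I \<in> X" and J: "J \<in> X" and "T I J \<noteq> 0"
  shows "\<exists>s\<in>insert \<alpha> I. J = succ_state \<alpha> I s \<and> (- lo \<in> I \<longrightarrow> s = - lo)"
proof -
  obtain s where s: "I \<union> {\<alpha>} = shift1 J \<union> {s}"
    using assms(3) by (auto simp: transfer_def split: if_splits)
  \<comment> \<open>Counting shows that \<open>s\<close> is not in \<open>shift1 J\<close>, so
    \<open>J\<close> arises from \<open>insert \<alpha> I\<close> by really removing
    \<open>s\<close>.\<close>
  have "card (shift1 J) = nat \<alpha>"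
    unfolding shift1_def using X_D[OF J] by (subst card_image) auto
  moreover have "card (I \<union> {\<alpha>}) = Suc (nat \<alpha>)" using X_D[OF I] by simp
  ultimately have "s \<notin> shift1 J" using s by (metis Un_insert_right insert_absorb n_not_Suc_n sup_bot_right)
  then have eq: "shift1 J = insert \<alpha> I - {s}" using s by auto
  have "- lo \<notin> shift1 J" using X_D(4)[OF J] by (force simp: shift1_def)
  then have "- lo \<in> I \<longrightarrow> s = - lo" using eq by auto
  moreover have "J = succ_state \<alpha> I s" using dec_shift1[of J] eq by simp
  moreover have "s \<in> insert \<alpha> I" using s by auto
  ultimately show ?thesis by metis
qed

lemma sum_transfer:
  assumes I: "I \<in> X"
  shows "(\<Sum>J\<in>X. T I J * f J) =
    (\<Sum>s\<in>{s \<in> insert \<alpha> I. - lo \<in> I \<longrightarrow> s = - lo}. eps s I * \<gamma> s * f (succ_state \<alpha> I s))"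
    (is "_ = sum _ ?V")
proof -
  have inj: "inj_on (succ_state \<alpha> I) ?V"
    by (rule inj_on_subset[OF inj_succ_state]) auto
  have "(\<Sum>J\<in>X. T I J * f J) = (\<Sum>J\<in>succ_state \<alpha> I ` ?V. T I J * f J)"
  proof (rule sum.mono_neutral_right[OF finite_X])
    show "succ_state \<alpha> I ` ?V \<subseteq> X" using succ_state_in_X[OF I] by auto
    show "\<forall>J\<in>X - succ_state \<alpha> I ` ?V. T I J * f J = 0"
    proof
      fix J assume J: "J \<in> X - succ_state \<alpha> I ` ?V"
      then have "T I J = 0" using transfer_nonzeroD[OF I, of J] by blast
      then show "T I J * f J = 0" by simp
    qed
  qed
  also have "\<dots> = (\<Sum>s\<in>?V. T I (succ_state \<alpha> I s) * f (succ_state \<alpha> I s))"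
    unfolding sum.reindex[OF inj] by (simp add: o_def)
  also have "\<dots> = (\<Sum>s\<in>?V. eps s I * \<gamma> s * f (succ_state \<alpha> I s))"
    using transfer_succ_state[OF I] by (intro sum.cong) auto
  finally show ?thesis .
qed

lemma finite_free_cols:
  assumes I: "I \<in> X"
  shows "finite (free_cols \<alpha> n I)"
proof -
  have "free_cols \<alpha> n I \<subseteq> I \<union> {\<alpha>..<int n}" by (auto simp: free_cols_def)
  then show ?thesis using X_D(1)[OF I] finite_subset by blast
qed

text \<open>If \<open>n < \<alpha>\<close>, the cut at \<open>n\<close> removes at most
  \<open>\<alpha> - n\<close> of the \<alpha> elements of \<open>I\<close>; otherwise exactly
  \<open>n\<close> columns remain.\<close>

lemma card_free_cols_ge:
  assumes I: "I \<in> X"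
  shows "n \<le> card (free_cols \<alpha> n I)"
proof (cases "\<alpha> \<le> int n")
  case True
  then have "free_cols \<alpha> n I = I \<union> {\<alpha>..<int n}" using X_D(4)[OF I] by (fastforce simp: free_cols_def)
  moreover have "I \<inter> {\<alpha>..<int n} = {}" using X_D(4)[OF I] by force
  ultimately show ?thesis using X_D[OF I] True \<alpha> by (simp add: card_Un_disjoint)
next
  case False
  have "I - {int n..<\<alpha>} \<subseteq> free_cols \<alpha> n I" using X_D(4)[OF I] by (fastforce simp: free_cols_def)
  then have "card (I - {int n..<\<alpha>}) \<le> card (free_cols \<alpha> n I)" by (rule card_mono[OF finite_free_cols[OF I]])
  moreover have "card I - card {int n..<\<alpha>} \<le> card (I - {int n..<\<alpha>})" by (rule diff_card_le_card_Diff) simp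
  ultimately show ?thesis using X_D(2)[OF I] False by simp
qed

text \<open>Expansion along the row and multiplication by \<open>T\<close> differ in zero terms
  only: weights beyond \<alpha>, choices that leave a column at \<open>- lo\<close> out of reach,
  and columns cut off at the right end. The later rows need only vanish left of \<open>- lo\<close>,
  so two kinds of rows can be stacked.\<close>

lemma minor_Cons_free_cols:
  assumes I: "I \<in> X" and rs: "\<And>r t. r \<in> set rs \<Longrightarrow> t < - lo \<Longrightarrow> r t = 0"
  shows "minor (\<gamma> # rs) (free_cols \<alpha> (Suc (length rs)) I) = (\<Sum>J\<in>X. T I J * minor rs (free_cols \<alpha> (length rs) J))"
proof -
  let ?n = "length rs"
  let ?C = "free_cols \<alpha> (Suc ?n) I"
  let ?V = "{s \<in> insert \<alpha> I. - lo \<in> I \<longrightarrow> s = - lo}"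
  have finC: "finite ?C" by (rule finite_free_cols[OF I])
  have le: "s \<le> \<alpha>" if "s \<in> insert \<alpha> I" for s using that X_D(4)[OF I] by force
  have succ: "free_cols \<alpha> ?n (succ_state \<alpha> I s) = dec (?C - {s})" if "s \<in> insert \<alpha> I" for s
  proof (rule Set.set_eqI)
    fix c
    show "c \<in> free_cols \<alpha> ?n (succ_state \<alpha> I s) \<longleftrightarrow> c \<in> dec (?C - {s})"
      using le[OF that] unfolding mem_dec free_cols_def by (auto simp: mem_dec)
  qed
  have "minor (\<gamma> # rs) ?C = (\<Sum>s\<in>?C \<inter> ?V. eps s ?C * \<gamma> s * minor rs (dec (?C - {s})))"
    unfolding minor.simps
  proof (rule sum.mono_neutral_right[OF finC])
    show "\<forall>s\<in>?C - ?C \<inter> ?V. eps s ?C * \<gamma> s * minor rs (dec (?C - {s})) = 0"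
    proof
      fix s assume s: "s \<in> ?C - ?C \<inter> ?V"
      show "eps s ?C * \<gamma> s * minor rs (dec (?C - {s})) = 0"
      proof (cases "s \<in> insert \<alpha> I")
        case True
        then have "- lo \<in> I" "s \<noteq> - lo" using s by auto
        then have "- lo - 1 \<in> dec (?C - {s})" using lo by (simp add: mem_dec free_cols_def)
        then have "minor rs (dec (?C - {s})) = 0"
          using finC by (rule_tac minor_eq_0_of_column) (auto intro: rs)
        then show ?thesis by simp
      next
        case False
        then have "s > \<alpha>" using s by (auto simp: free_cols_def)
        then show ?thesis by (simp add: band)
      qed
    qed
  qed auto
  also have "\<dots> = (\<Sum>s\<in>?C \<inter> ?V. eps s I * \<gamma> s * minor rs (free_cols \<alpha> ?n (succ_state \<alpha> I s)))"
  proof (rule sum.cong[OF refl])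
    fix s assume s: "s \<in> ?C \<inter> ?V"
    then have "{c \<in> ?C. c < s} = {c \<in> I. c < s}" using le[of s] by (auto simp: free_cols_def)
    then have "eps s ?C = (eps s I :: 'k)" by (simp add: eps_def)
    then show "eps s ?C * \<gamma> s * minor rs (dec (?C - {s}))
        = eps s I * \<gamma> s * minor rs (free_cols \<alpha> ?n (succ_state \<alpha> I s))"
      using s succ[of s] by simp
  qed
  also have "\<dots> = (\<Sum>s\<in>?V. eps s I * \<gamma> s * minor rs (free_cols \<alpha> ?n (succ_state \<alpha> I s)))"
  proof (rule sum.mono_neutral_left)
    show "finite ?V" using X_D(1)[OF I] by simp
    show "\<forall>s\<in>?V - ?C \<inter> ?V. eps s I * \<gamma> s * minor rs (free_cols \<alpha> ?n (succ_state \<alpha> I s)) = 0"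
    proof
      fix s assume s: "s \<in> ?V - ?C \<inter> ?V"
      \<comment> \<open>Here \<open>s\<close> is past the right end and nothing is removed, so more
        columns than rows remain.\<close>
      then have "free_cols \<alpha> ?n (succ_state \<alpha> I s) = dec ?C" using succ[of s] by auto
      moreover have "minor rs (dec ?C) = 0"
        using finC card_free_cols_ge[OF I, of "Suc ?n"] by (intro minor_eq_0_of_card) (auto simp: card_dec)
      ultimately show "eps s I * \<gamma> s * minor rs (free_cols \<alpha> ?n (succ_state \<alpha> I s)) = 0" by simp
    qed
  qed auto
  also have "\<dots> = (\<Sum>J\<in>X. T I J * minor rs (free_cols \<alpha> ?n J))"
    by (rule sum_transfer[OF I, symmetric])
  finally show ?thesis .
qed

lemma initial_in_X: "{0..\<alpha> - 1} \<in> X"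
  using lo by (auto simp: X_iff)

text \<open>With no rows left no negative offset may be free, which singles out
  \<open>{0..\<alpha> - 1}\<close> among the states; each further row is one factor
  \<open>T\<close>.\<close>

lemma pow_column_eq_minor:
  assumes "I \<in> X"
  shows "pow_column X T {0..\<alpha> - 1} n I = minor (replicate n \<gamma>) (free_cols \<alpha> n I)"
  using assms
proof (induction n arbitrary: I)
  case 0
  have "free_cols \<alpha> 0 I = {} \<longleftrightarrow> I = {0..\<alpha> - 1}"
  proof
    assume c: "free_cols \<alpha> 0 I = {}"
    have "I \<subseteq> {0..\<alpha> - 1}"
    proof
      fix i assume i: "i \<in> I"
      then have "i \<notin> free_cols \<alpha> 0 I" using c by simp
      then show "i \<in> {0..\<alpha> - 1}" using i X_D(4)[OF 0 i] by (auto simp: free_cols_def)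
    qed
    then show "I = {0..\<alpha> - 1}" using X_D(2)[OF 0] by (intro card_subset_eq) auto
  qed (use \<alpha> in \<open>auto simp: free_cols_def\<close>)
  then show ?case by simp
next
  case (Suc n)
  then show ?case
    using minor_Cons_free_cols[of I "replicate n \<gamma>"] by (simp add: band)
qed

text \<open>The induction turns the factor \<open>T\<close> next to \<open>rs\<close> into one more
  row in front of \<open>rs\<close>, hence \<open>rs\<close> is generalised.\<close>

lemma sum_pow_row_minor:
  assumes I: "I \<in> X" and rs: "\<And>r t. r \<in> set rs \<Longrightarrow> t < - lo \<Longrightarrow> r t = 0"
  shows "(\<Sum>J\<in>X. pow_column X (\<lambda>i j. T j i) I l J * minor rs (free_cols \<alpha> (length rs) J))
    = minor (replicate l \<gamma> @ rs) (free_cols \<alpha> (l + length rs) I)"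
  using rs
proof (induction l arbitrary: rs)
  case 0
  have "(\<Sum>J\<in>X. pow_column X (\<lambda>i j. T j i) I 0 J * minor rs (free_cols \<alpha> (length rs) J))
      = (\<Sum>J\<in>X. if J = I then minor rs (free_cols \<alpha> (length rs) J) else 0)"
    by (intro sum.cong) auto
  then show ?case using I finite_X by simp
next
  case (Suc l)
  have "(\<Sum>J\<in>X. pow_column X (\<lambda>i j. T j i) I (Suc l) J * minor rs (free_cols \<alpha> (length rs) J))
     = (\<Sum>K\<in>X. pow_column X (\<lambda>i j. T j i) I l K * (\<Sum>J\<in>X. T K J * minor rs (free_cols \<alpha> (length rs) J)))"
    by (simp add: sum_distrib_left sum_distrib_right mult_ac) (rule sum.swap)
  also have "\<dots> = (\<Sum>K\<in>X. pow_column X (\<lambda>i j. T j i) I l K * minor (\<gamma> # rs) (free_cols \<alpha> (length (\<gamma> # rs)) K))"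
    using Suc.prems by (intro sum.cong refl) (simp add: minor_Cons_free_cols del: minor.simps)
  also have "\<dots> = minor (replicate l \<gamma> @ \<gamma> # rs) (free_cols \<alpha> (l + length (\<gamma> # rs)) I)"
    using Suc.prems by (intro Suc.IH) (auto simp: band)
  also have "replicate l \<gamma> @ \<gamma> # rs = replicate (Suc l) \<gamma> @ rs"
    by (simp add: replicate_app_Cons_same)
  finally show ?case by simp
qed

text \<open>
  The rotation of the interval of offsets induces the only permutation contributing to \<open>det T\<close>.
\<close>
definition rot :: "int set \<Rightarrow> int set" where
  "rot I = (\<lambda>x. if x = - lo then \<alpha> - 1 else x - 1) ` I"

abbreviation "P \<equiv> {I \<in> X. - lo \<in> I}"

lemma bij_rot: "bij_betw rot X X"
proof -
  let ?r = "\<lambda>x. if x = - lo then \<alpha> - 1 else x - 1"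
  have inj: "inj_on ?r {-lo..\<alpha>-1}" by (auto simp: inj_on_def)
  have "inj_on (image ?r) X"
    by (rule inj_on_subset[OF inj_on_image_Pow[OF inj]]) (unfold states_def nsubsets_def, blast)
  then have inj': "inj_on rot X" unfolding rot_def[abs_def] .
  have "rot ` X \<subseteq> X"
  proof
    fix J assume "J \<in> rot ` X"
    then obtain I where I: "I \<in> X" "J = ?r ` I" by (auto simp: rot_def)
    have "card J = card I" unfolding I(2)
      by (rule card_image, rule inj_on_subset[OF inj]) (use I in \<open>auto simp: X_iff\<close>)
    then show "J \<in> X" using I X_D[OF I(1)] by (fastforce simp: X_iff)
  qed
  then show ?thesis using inj' endo_inj_surj[OF finite_X] by (auto simp: bij_betw_def)
qed

lemma rot_in_X: "I \<in> X \<Longrightarrow> rot I \<in> X"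
  using bij_rot by (auto simp: bij_betw_def)

text \<open>The incoming column \<alpha> lands at \<open>\<alpha> - 1\<close>, where
  \<open>rot\<close> sends \<open>- lo\<close>. Using \<open>- lo\<close> thus realises the
  wrap-around, using \<alpha> the pure shift.\<close>

lemma rot_cases:
  assumes I: "I \<in> X"
  shows "- lo \<in> I \<Longrightarrow> rot I = succ_state \<alpha> I (- lo)"
    and "- lo \<notin> I \<Longrightarrow> rot I = succ_state \<alpha> I \<alpha>"
    and "\<alpha> - 1 \<in> rot I \<longleftrightarrow> - lo \<in> I"
proof -
  have ne: "\<alpha> \<notin> I" "\<alpha> \<noteq> - lo" using X_D[OF I] \<alpha> lo by auto
  show "rot I = succ_state \<alpha> I (- lo)" if "- lo \<in> I"
  proof -
    have "rot I = insert (\<alpha> - 1) (dec (I - {- lo}))" using that by (force simp: rot_def)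
    also have "\<dots> = succ_state \<alpha> I (- lo)" using ne by auto
    finally show ?thesis .
  qed
  show "rot I = succ_state \<alpha> I \<alpha>" if "- lo \<notin> I"
    using that ne by (auto simp: rot_def)
  show "\<alpha> - 1 \<in> rot I \<longleftrightarrow> - lo \<in> I"
    using ne by (auto simp: rot_def)
qed

lemma rot_P: "rot ` P = {J \<in> X. \<alpha> - 1 \<in> J}"
proof (intro equalityI subsetI)
  fix J assume J: "J \<in> {J \<in> X. \<alpha> - 1 \<in> J}"
  then obtain I where "I \<in> X" "J = rot I" using bij_rot by (auto simp: bij_betw_def)
  then show "J \<in> rot ` P" using rot_cases(3) J by blast
qed (use rot_in_X rot_cases(3) in blast)

lemma eps_nonzero: "(eps s I :: 'k) \<noteq> 0"
  by (simp add: eps_def)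

text \<open>The column \<open>- lo\<close> must be used at once, with the nonzero weight at the
  lower end of the band.\<close>

lemma transfer_row:
  assumes "I \<in> P" "J \<in> X"
  shows "T I J \<noteq> 0 \<longleftrightarrow> J = rot I"
proof -
  have I: "I \<in> X" "- lo \<in> I" using assms by auto
  have "T I (rot I) \<noteq> 0"
    using rot_cases(1)[OF I] transfer_succ_state[OF I(1), of "- lo"] I eps_nonzero bot by simp
  then show ?thesis
    using transfer_nonzeroD[OF I(1) assms(2)] rot_cases(1)[OF I] I(2) by metis
qed

text \<open>Offset \<open>\<alpha> - 1\<close> is empty after a row only if \<alpha> was used, with
  the nonzero weight at the upper end.\<close>

lemma transfer_col:
  assumes I: "I \<in> X" and J: "J \<in> X" "J \<notin> rot ` P"
  shows "T I J \<noteq> 0 \<longleftrightarrow> J = rot I"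
proof
  have \<alpha>J: "\<alpha> - 1 \<notin> J" using J rot_P by auto
  assume "T I J \<noteq> 0"
  then obtain s where s: "s \<in> insert \<alpha> I" "J = succ_state \<alpha> I s" "- lo \<in> I \<longrightarrow> s = - lo"
    using transfer_nonzeroD[OF I J(1)] by blast
  have "s = \<alpha>" using \<alpha>J s(2) by (auto simp: mem_dec)
  then show "J = rot I" using s rot_cases(2)[OF I] \<alpha> lo by auto
next
  assume eq: "J = rot I"
  then have "- lo \<notin> I" using J rot_P rot_cases(3)[OF I] by auto
  then show "T I J \<noteq> 0"
    using eq rot_cases(2)[OF I] transfer_succ_state[OF I, of \<alpha>] eps_nonzero top by auto
qed

lemma degree_det: "degree (det_on X (id_minus_z T)) = nat (\<alpha> + lo) choose nat \<alpha>"
proof -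
  have "det_on X T \<noteq> 0"
    by (rule det_on_ne_0_of_unique_permutation[OF finite_X bij_rot _ transfer_row transfer_col]) auto
  then show ?thesis using det_id_minus_z[OF finite_X] card_X by simp
qed

end

section \<open>Top coefficients of adjugate entries in the row and column of the initial
  state\<close>

context band
begin

text \<open>Under \<open>rot\<close> the initial interval slides left and first contains
  \<open>- lo\<close> after \<open>lo\<close> steps; the next step wraps \<open>- lo\<close> to
  \<open>\<alpha> - 1\<close>. The states containing \<open>\<alpha> - 1\<close> form the image of
  \<open>P\<close>.\<close>

lemma top_coeffs_adj_column:
  assumes "\<alpha> \<ge> 1"
  shows "nat lo < card X"
    and "\<And>J m. J \<in> X \<Longrightarrow> \<alpha> - 1 \<in> J \<Longrightarrow> card X - nat lo \<le> m \<Longrightarrow>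
      coeff (adj_on X (id_minus_z T) J {0..\<alpha> - 1}) m = 0"
    and "\<And>J. J \<in> X \<Longrightarrow> \<alpha> - 1 \<in> J \<Longrightarrow>
      coeff (adj_on X (id_minus_z T) J {0..\<alpha> - 1}) (card X - Suc (nat lo)) \<noteq> 0
        \<longleftrightarrow> J = insert (\<alpha> - 1) {- lo..\<alpha> - 2 - lo}"
proof -
  define s where "s i = {- int i..\<alpha> - 1 - int i}" for i
  have sX: "s i \<in> X" if "i \<le> nat lo" for i
    using that lo by (auto simp: s_def X_iff)
  have s0: "s 0 = {0..\<alpha> - 1}" by (simp add: s_def)
  have notP: "s i \<notin> P" if "i < nat lo" for i
    using that by (auto simp: s_def)
  have sSuc: "s (Suc i) = rot (s i)" if "i < nat lo" for i
  proof -
    have "\<alpha> \<notin> s i" by (simp add: s_def)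
    then have "rot (s i) = dec (s i)" using rot_cases(2)[OF sX, of i] notP[OF that] sX[of i] that by simp
    then show ?thesis by (auto simp: s_def mem_dec)
  qed
  have sP: "s (nat lo) \<in> P"
    using sX[of "nat lo"] assms lo by (auto simp: s_def)
  have rot_sP: "rot (s (nat lo)) = insert (\<alpha> - 1) {- lo..\<alpha> - 2 - lo}"
  proof -
    have "rot (s (nat lo)) = dec (insert \<alpha> (s (nat lo)) - {- lo})"
      using rot_cases(1) sP by auto
    also have "\<dots> = insert (\<alpha> - 1) {- lo..\<alpha> - 2 - lo}"
      using lo \<alpha> by (auto simp: s_def mem_dec)
    finally show ?thesis .
  qed
  have lead: "coeff (det_on X (id_minus_z T)) (card X) \<noteq> 0"
    using degree_det card_X leading_coeff_0_iff[of "det_on X (id_minus_z T)"]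
      finite_X initial_in_X by (metis card_0_eq degree_0 empty_iff)
  note * = top_coeffs_of_recurrence[where x = "\<lambda>I. coeff (adj_on X (id_minus_z T) I (s 0))"
      and s = s and T = T, OF finite_X bij_rot _ transfer_row transfer_col
      coeff_adj_id_minus_z(1)[OF finite_X _ sX[OF le0]] coeff_adj_id_minus_z(2)[OF finite_X _ sX[OF le0]]
      coeff_eq_0[OF less_le_trans[OF degree_adj_id_minus_z[OF finite_X sX[OF le0]]]] lead
      sX[OF le0] sSuc notP sP]
  show "nat lo < card X" by (rule *(1)) auto
  show "coeff (adj_on X (id_minus_z T) J {0..\<alpha> - 1}) m = 0"
    if "J \<in> X" "\<alpha> - 1 \<in> J" "card X - nat lo \<le> m" for J m
    unfolding s0[symmetric] by (rule *(2)) (use that rot_P in auto)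
  show "coeff (adj_on X (id_minus_z T) J {0..\<alpha> - 1}) (card X - Suc (nat lo)) \<noteq> 0
        \<longleftrightarrow> J = insert (\<alpha> - 1) {- lo..\<alpha> - 2 - lo}" if "J \<in> X" "\<alpha> - 1 \<in> J" for J
    unfolding s0[symmetric] rot_sP[symmetric] by (rule *(3)) (use that rot_P in auto)
qed

text \<open>
  The recurrence lemma applied to the transposed matrix and the inverse rotation.
\<close>
lemma top_coeffs_adj_row:
  shows "nat \<alpha> < card X"
    and "\<And>I m. I \<in> X \<Longrightarrow> - lo \<notin> I \<Longrightarrow> card X - nat \<alpha> \<le> m \<Longrightarrow>
      coeff (adj_on X (id_minus_z T) {0..\<alpha> - 1} I) m = 0"
    and "\<And>I. I \<in> X \<Longrightarrow> - lo \<notin> I \<Longrightarrow>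
      coeff (adj_on X (id_minus_z T) {0..\<alpha> - 1} I) (card X - Suc (nat \<alpha>)) \<noteq> 0
        \<longleftrightarrow> I = {1 - lo..\<alpha> - lo}"
proof -
  let ?T' = "\<lambda>i j. T j i"
  define \<psi> where "\<psi> = inv_into X rot"
  have \<psi>: "bij_betw \<psi> X X" unfolding \<psi>_def by (rule bij_betw_inv_into[OF bij_rot])
  have \<psi>_iff: "I = \<psi> J \<longleftrightarrow> J = rot I" if "I \<in> X" "J \<in> X" for I J
    using that bij_rot unfolding \<psi>_def
    by (metis bij_betw_inv_into_left bij_betw_inv_into_right)
  \<comment> \<open>The monomial rows of the transpose are the columns of \<open>T\<close> outside
    the image of \<open>P\<close>, so this complement takes the place of \<open>P\<close>.\<close>
  have \<psi>P: "\<psi> ` (X - rot ` P) = {I \<in> X. - lo \<notin> I}"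
  proof (intro equalityI subsetI)
    fix I assume "I \<in> \<psi> ` (X - rot ` P)"
    then obtain J where J: "J \<in> X" "J \<notin> rot ` P" "I = \<psi> J" by auto
    then have I: "I \<in> X" using \<psi> by (auto simp: bij_betw_def)
    then have "J = rot I" using \<psi>_iff[OF I J(1)] J(3) by simp
    then show "I \<in> {I \<in> X. - lo \<notin> I}" using I J(2) by blast
  next
    fix I assume I: "I \<in> {I \<in> X. - lo \<notin> I}"
    then have "rot I \<in> X - rot ` P" using rot_in_X rot_P rot_cases(3) by auto
    moreover have "I = \<psi> (rot I)" using \<psi>_iff rot_in_X I by auto
    ultimately show "I \<in> \<psi> ` (X - rot ` P)" by blast
  qed
  \<comment> \<open>The orbit under the inverse rotation: elements move right and the top one wraps
    to \<open>- lo\<close>, so \<open>\<alpha> - 1\<close> is first missing after \<alpha>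
    steps.\<close>
  define s where "s i = {- lo..<- lo + int i} \<union> {int i..\<alpha> - 1}" for i
  have sX: "s i \<in> X" if "i \<le> nat \<alpha>" for i
  proof -
    have "card (s i) = nat \<alpha>" unfolding s_def
      using that lo \<alpha> by (subst card_Un_disjoint) auto
    then show ?thesis using that lo \<alpha> by (auto simp: s_def X_iff)
  qed
  have s0: "s 0 = {0..\<alpha> - 1}" by (simp add: s_def)
  have sSuc: "s (Suc i) = \<psi> (s i)" if "i < nat \<alpha>" for i
  proof -
    have *: "s (Suc i) \<in> X" "- lo \<in> s (Suc i)" using sX[of "Suc i"] that by (auto simp: s_def)
    have "rot (s (Suc i)) = dec (insert \<alpha> (s (Suc i)) - {- lo})"
      by (rule rot_cases(1)[OF *])
    also have "\<dots> = s i" using that lo \<alpha> by (auto simp: s_def mem_dec)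
    finally show ?thesis using \<psi>_iff[OF *(1), of "s i"] sX[of i] that by simp
  qed
  have notP: "s i \<notin> X - rot ` P" if "i < nat \<alpha>" for i
    using that sX[of i] by (auto simp: rot_P s_def)
  have sP: "s (nat \<alpha>) \<in> X - rot ` P"
    using sX[of "nat \<alpha>"] lo \<alpha> by (auto simp: rot_P s_def)
  have \<psi>_sP: "\<psi> (s (nat \<alpha>)) = {1 - lo..\<alpha> - lo}"
  proof -
    have I: "{1 - lo..\<alpha> - lo} \<in> X" using lo \<alpha> by (auto simp: X_iff)
    have "rot {1 - lo..\<alpha> - lo} = dec (insert \<alpha> {1 - lo..\<alpha> - lo} - {\<alpha>})"
      by (rule rot_cases(2)[OF I]) auto
    also have "\<dots> = s (nat \<alpha>)" using lo \<alpha> by (auto simp: s_def mem_dec)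
    finally have "{1 - lo..\<alpha> - lo} = \<psi> (s (nat \<alpha>))" using \<psi>_iff[OF I sX[OF order_refl]] by simp
    then show ?thesis ..
  qed
  have det: "det_on X (id_minus_z ?T') = det_on X (id_minus_z T)"
    unfolding id_minus_z_transpose[of T] by (rule det_on_transpose[OF finite_X])
  have adj: "adj_on X (id_minus_z T) {0..\<alpha> - 1} I = adj_on X (id_minus_z ?T') I (s 0)" if "I \<in> X" for I
    unfolding id_minus_z_transpose[of T] s0
    by (rule adj_on_transpose[OF finite_X that initial_in_X, symmetric])
  have lead: "coeff (det_on X (id_minus_z ?T')) (card X) \<noteq> 0"
    unfolding det
    using degree_det card_X leading_coeff_0_iff[of "det_on X (id_minus_z T)"]
      finite_X initial_in_X by (metis card_0_eq degree_0 empty_iff)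
  have row: "T J I \<noteq> 0 \<longleftrightarrow> J = \<psi> I" if "I \<in> X - rot ` P" "J \<in> X" for I J
    using transfer_col[of J I] \<psi>_iff[of J I] that by auto
  have col: "T J I \<noteq> 0 \<longleftrightarrow> J = \<psi> I" if "I \<in> X" "J \<in> X" "J \<notin> \<psi> ` (X - rot ` P)" for I J
    using transfer_row[of J I] \<psi>_iff[of J I] that unfolding \<psi>P by auto
  note * = top_coeffs_of_recurrence[where x = "\<lambda>I. coeff (adj_on X (id_minus_z ?T') I (s 0))"
      and s = s and T = ?T', OF finite_X \<psi> _ row col
      coeff_adj_id_minus_z(1)[OF finite_X _ sX[OF le0]] coeff_adj_id_minus_z(2)[OF finite_X _ sX[OF le0]]
      coeff_eq_0[OF less_le_trans[OF degree_adj_id_minus_z[OF finite_X sX[OF le0]]]] lead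
      sX[OF le0] sSuc notP sP]
  show "nat \<alpha> < card X" by (rule *(1)) auto
  show "coeff (adj_on X (id_minus_z T) {0..\<alpha> - 1} I) m = 0"
    if "I \<in> X" "- lo \<notin> I" "card X - nat \<alpha> \<le> m" for I m
    unfolding adj[OF that(1)] by (rule *(2)) (use that \<psi>P in auto)
  show "coeff (adj_on X (id_minus_z T) {0..\<alpha> - 1} I) (card X - Suc (nat \<alpha>)) \<noteq> 0
        \<longleftrightarrow> I = {1 - lo..\<alpha> - lo}" if "I \<in> X" "- lo \<notin> I" for I
    unfolding adj[OF that(1)] \<psi>_sP[symmetric] by (rule *(3)) (use that \<psi>P in auto)
qed

end

section \<open>The cofactors \<open>Fkl\<close> as minors with two kinds of rows\<close>

lemma minor_replicate_uminus:
  "minor (replicate l (\<lambda>t. - g t) @ rs) C = (-1) ^ l * minor (replicate l g @ rs) C"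
  by (induction l arbitrary: C) (simp_all add: sum_distrib_left sum_negf mult_ac)

text \<open>Without column 0, column \<open>j\<close> is the original \<open>j + 1\<close>. Rows
  above the deleted one have entries \<open>beta (j + 1 - i) = - betat (j - i)\<close>, rows below
  it \<open>beta (j - i)\<close>; the \<open>l\<close> signs cancel the cofactor sign.\<close>

lemma Fkl_eq_minor:
  assumes "l \<le> k"
  shows "Fkl \<omega> k l = minor (replicate l (betat \<omega>) @ replicate (k - l) (beta \<omega>)) {0..<int k}"
proof -
  let ?rs = "replicate l (\<lambda>t. - betat \<omega> t) @ replicate (k - l) (beta \<omega>)"
  let ?cs = "map int [0..<k]"
  have "det_on {0..<k} (\<lambda>r c. let i = (if r < l then r else r + 1); j = c + 1 in
            (if i = j then 1 else 0) - Amat \<omega> i j)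
      = det_on {0..<length ?cs} (\<lambda>i j. (?rs ! i) (?cs ! j - int i))"
    unfolding length_map length_upt diff_zero
  proof (rule det_on_cong)
    fix i j assume i: "i \<in> {0..<k}" and j: "j \<in> {0..<k}"
    show "(let i = if i < l then i else i + 1; j = j + 1 in (if i = j then 1 else 0) - Amat \<omega> i j)
        = (?rs ! i) (?cs ! j - int i)"
      using i j by (auto simp: Let_def nth_append Amat_def beta_def betat_def algebra_simps)
  qed
  also have "\<dots> = minor ?rs (set ?cs)"
    using assms by (intro det_eq_minor) (auto simp: sorted_wrt_map)
  also have "set ?cs = {0..<int k}"
    by (simp add: image_int_atLeastLessThan)
  finally show ?thesis
    by (simp add: Fkl_def minor_replicate_uminus flip: mult.assoc power_mult_distrib)
qed

lemma coeff_mult_of_degree_le: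
  assumes "degree p \<le> m" and "degree q \<le> n"
  shows "coeff (p * q) (m + n) = coeff p m * coeff q n"
proof (cases "degree p = m \<and> degree q = n")
  case True
  then show ?thesis using coeff_mult_degree_sum[of p q] by simp
next
  case False
  then have "degree p < m \<or> degree q < n" using assms by auto
  then have "coeff p m * coeff q n = 0" by (auto simp: coeff_eq_0)
  moreover have "degree (p * q) < m + n"
    using degree_mult_le[of p q] assms False by linarith
  ultimately show ?thesis by (simp add: coeff_eq_0)
qed

section \<open>The generating function\<close>

text \<open>The substitution of \<open>uz\<close> for \<open>z\<close>, matching
  \<open>evalR\<close> at \<open>uR * zR\<close>; \<open>const_fps\<close> matches
  \<open>evalR\<close> at \<open>zR\<close>.\<close>

definition scale_fps :: "'k::comm_ring_1 fps \<Rightarrow> 'k poly fps" where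
  "scale_fps f = Abs_fps (\<lambda>n. monom (fps_nth f n) n)"

definition const_fps :: "'k::comm_ring_1 fps \<Rightarrow> 'k poly fps" where
  "const_fps f = Abs_fps (\<lambda>n. [:fps_nth f n:])"

lemma monom_sum: "monom (sum f A) n = (\<Sum>i\<in>A. monom (f i) n)"
  by (rule poly_eqI) (simp add: coeff_sum)

lemma scale_fps_mult: "scale_fps (f * g) = scale_fps f * scale_fps g"
  by (rule fps_ext) (auto simp: scale_fps_def fps_mult_nth monom_sum mult_monom intro!: sum.cong)

lemma const_fps_mult: "const_fps (f * g) = const_fps f * const_fps g"
  by (rule fps_ext) (simp add: const_fps_def fps_mult_nth monom_sum mult_monom flip: monom_0)

lemma scale_fps_of_poly: "fps_of_poly (evalR p (uR * zR)) = scale_fps (fps_of_poly p)"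
  by (rule fps_ext) (simp add: scale_fps_def coeff_evalR_uR_zR)

lemma const_fps_of_poly: "fps_of_poly (evalR p zR) = const_fps (fps_of_poly p)"
  by (rule fps_ext) (simp add: const_fps_def coeff_evalR_zR)

lemma evalR_id_minus_z: "evalR (id_minus_z T i j) x = (if i = j then 1 else 0) - x * cR (T i j)"
proof -
  interpret comm_ring_hom "\<lambda>p :: 'a poly. evalR p x" by (rule evalR_hom)
  have "evalR [:0, T i j:] x = x * cR (T i j)"
    by (simp add: evalR_pCons) (simp add: cR_def evalR_def)
  then show ?thesis by (simp add: id_minus_z_def hom_minus)
qed

section \<open>The two bands, for \<open>beta\<close> and \<open>betat\<close>, and their coupling
  by \<open>U\<close>\<close>

locale step_weights =
  fixes \<omega> :: "int \<Rightarrow> 'k::field_char_0" and a b :: int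
  assumes a: "a \<ge> 1" and b: "b \<ge> 1"
    and supp: "s < - b \<or> a < s \<Longrightarrow> \<omega> s = 0"
    and \<omega>a: "\<omega> a \<noteq> 0" and \<omega>b: "\<omega> (- b) \<noteq> 0"
begin

sublocale B: band "beta \<omega>" a b
  using a b supp \<omega>a \<omega>b by unfold_locales (auto simp: beta_def)

sublocale Bt: band "betat \<omega>" "a - 1" "b + 1"
  using a b supp \<omega>a \<omega>b by unfold_locales (auto simp: beta_def betat_def)

lemma Idx_eq: "Idx a b = B.X"
  by (simp add: Idx_def states_def)

lemma Idxt_eq: "Idxt a b = Bt.X"
proof -
  have "- b - 1 = - (b + 1)" "a - 2 = a - 1 - 1" by simp_all
  then show ?thesis by (simp only: Idxt_def states_def)
qed

lemma Tmat_eq: "Tmat \<omega> a = B.T"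
  by (simp add: fun_eq_iff Tmat_def transfer_def)

lemma Ttmat_eq: "Ttmat \<omega> a = Bt.T"
  by (simp add: fun_eq_iff Ttmat_def transfer_def)

lemma Dpoly_eq: "Dpoly \<omega> a b = det_on B.X (id_minus_z B.T)"
  by (simp add: Dpoly_def Idx_eq Tmat_eq id_minus_z_def[abs_def])

lemma Dtpoly_eq: "Dtpoly \<omega> a b = det_on Bt.X (id_minus_z Bt.T)"
  by (simp add: Dtpoly_def Idxt_eq Ttmat_eq id_minus_z_def[abs_def])

text \<open>The nonzero rows of \<open>U\<close>: for these \<open>J\<close>, adding
  \<open>a - 1\<close> gives an index of \<open>T\<close>.\<close>

definition U_rows :: "int set set" where
  "U_rows = {J \<in> Bt.X. - (b + 1) \<notin> J}"

text \<open>The bound \<open>a - 1 - 1\<close> is the locale's \<open>\<alpha> - 1\<close> at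
  \<open>\<alpha> = a - 1\<close>.\<close>

definition row :: "int set \<Rightarrow> 'k poly" where
  "row J = adj_on Bt.X (id_minus_z Bt.T) {0..a - 1 - 1} J"

definition col :: "int set \<Rightarrow> 'k poly" where
  "col K = adj_on B.X (id_minus_z B.T) K {0..a - 1}"

lemma finite_U_rows: "finite U_rows"
  using Bt.finite_X by (simp add: U_rows_def)

lemma insert_in_X_iff:
  assumes J: "J \<in> Bt.X"
  shows "insert (a - 1) J \<in> B.X \<longleftrightarrow> J \<in> U_rows"
proof -
  have "card (insert (a - 1) J) = nat a" using Bt.X_D[OF J] a by simp
  moreover have "insert (a - 1) J \<subseteq> {- b..a - 1} \<longleftrightarrow> - (b + 1) \<notin> J"
  proof
    assume "- (b + 1) \<notin> J"
    then have "- b \<le> j \<and> j \<le> a - 1" if "j \<in> J" for j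
      using Bt.X_D(4)[OF J that] that by (cases "j = - (b + 1)") auto
    then show "insert (a - 1) J \<subseteq> {- b..a - 1}" using a b by auto
  qed auto
  ultimately show ?thesis using J by (simp add: B.X_iff U_rows_def)
qed

lemma sum_Umat:
  assumes J: "J \<in> Bt.X"
  shows "(\<Sum>K\<in>B.X. p * cR (Umat a J K) * f K) = (if J \<in> U_rows then p * f (insert (a - 1) J) else 0)"
proof -
  have "(\<Sum>K\<in>B.X. p * cR (Umat a J K) * f K) = (\<Sum>K\<in>B.X. if K = insert (a - 1) J then p * f K else 0)"
    by (intro sum.cong refl) (auto simp: Umat_def cR_def simp flip: one_pCons)
  then show ?thesis using insert_in_X_iff[OF J] B.finite_X by simp
qed

lemma Ntilde_eq: "Ntilde \<omega> a b = (\<Sum>J\<in>U_rows. evalR (row J) (uR * zR) * evalR (col (insert (a - 1) J)) zR)"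
proof -
  have row: "adj_on (Idxt a b) (\<lambda>I J. (if I = J then 1 else 0) - uR * zR * cR (Ttmat \<omega> a I J)) {0..a - 2} J
      = evalR (row J) (uR * zR)" for J
    unfolding row_def comm_ring_hom.hom_adj_on[OF evalR_hom] evalR_id_minus_z Idxt_eq Ttmat_eq by simp
  have col: "adj_on (Idx a b) (\<lambda>I J. (if I = J then 1 else 0) - zR * cR (Tmat \<omega> a I J)) K {0..a - 1}
      = evalR (col K) zR" for K
    unfolding col_def comm_ring_hom.hom_adj_on[OF evalR_hom] evalR_id_minus_z Idx_eq Tmat_eq by simp
  have "Ntilde \<omega> a b = (\<Sum>J\<in>Bt.X. if J \<in> U_rows then evalR (row J) (uR * zR) * evalR (col (insert (a - 1) J)) zR else 0)"
    unfolding Ntilde_def Let_def row col unfolding Idxt_eq Idx_eq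
    by (intro sum.cong refl sum_Umat)
  also have "\<dots> = (\<Sum>J\<in>U_rows. evalR (row J) (uR * zR) * evalR (col (insert (a - 1) J)) zR)"
    using Bt.finite_X by (simp add: sum.If_cases U_rows_def Int_def)
  finally show ?thesis .
qed

text \<open>The first \<open>l\<close> rows are absorbed by the \<open>betat\<close> matrix, the
  others by \<open>T\<close>. In between, a state containing \<open>- (b + 1)\<close> drops out
  because no \<open>beta\<close> row reaches that column.\<close>

lemma Fkl_eq:
  assumes "l \<le> k"
  shows "Fkl \<omega> k l = (\<Sum>J\<in>U_rows. pow_column Bt.X (\<lambda>i j. Bt.T j i) {0..a - 1 - 1} l J
      * pow_column B.X B.T {0..a - 1} (k - l) (insert (a - 1) J))"
proof -
  let ?rs = "replicate (k - l) (beta \<omega>)"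
  let ?p = "pow_column Bt.X (\<lambda>i j. Bt.T j i) {0..a - 1 - 1} l"
  have "{0..<int k} = free_cols (a - 1) (l + length ?rs) {0..a - 1 - 1}"
    using assms a by (auto simp: free_cols_def)
  then have "Fkl \<omega> k l = minor (replicate l (betat \<omega>) @ ?rs) (free_cols (a - 1) (l + length ?rs) {0..a - 1 - 1})"
    using Fkl_eq_minor[OF assms] by simp
  also have "\<dots> = (\<Sum>J\<in>Bt.X. ?p J * minor ?rs (free_cols (a - 1) (length ?rs) J))"
    by (rule Bt.sum_pow_row_minor[OF Bt.initial_in_X, symmetric]) (auto simp: B.band)
  also have "\<dots> = (\<Sum>J\<in>U_rows. ?p J * minor ?rs (free_cols (a - 1) (length ?rs) J))"
  proof (rule sum.mono_neutral_right[OF Bt.finite_X])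
    show "\<forall>J\<in>Bt.X - U_rows. ?p J * minor ?rs (free_cols (a - 1) (length ?rs) J) = 0"
    proof
      fix J assume J: "J \<in> Bt.X - U_rows"
      then have "minor ?rs (free_cols (a - 1) (length ?rs) J) = 0"
        using b Bt.finite_free_cols
        by (intro minor_eq_0_of_column[of _ "- (b + 1)"]) (auto simp: free_cols_def U_rows_def B.band)
      then show "?p J * minor ?rs (free_cols (a - 1) (length ?rs) J) = 0" by simp
    qed
  qed (auto simp: U_rows_def)
  also have "\<dots> = (\<Sum>J\<in>U_rows. ?p J * pow_column B.X B.T {0..a - 1} (k - l) (insert (a - 1) J))"
  proof (rule sum.cong[OF refl])
    fix J assume J: "J \<in> U_rows"
    then have "insert (a - 1) J \<in> B.X" using insert_in_X_iff[of J] by (auto simp: U_rows_def)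
    \<comment> \<open>The handover: column \<open>a - 1\<close> lies just past the
      \<open>betat\<close> states but belongs to the \<open>beta\<close> state, and the free columns
      are the same.\<close>
    moreover have "free_cols (a - 1) (k - l) J = free_cols a (k - l) (insert (a - 1) J)"
      by (auto simp: free_cols_def)
    ultimately show "?p J * minor ?rs (free_cols (a - 1) (length ?rs) J)
        = ?p J * pow_column B.X B.T {0..a - 1} (k - l) (insert (a - 1) J)"
      using B.pow_column_eq_minor by simp
  qed
  finally show ?thesis .
qed

text \<open>By \<open>Fkl_eq\<close> the series is a sum over \<open>U_rows\<close> of products of a
  series in \<open>uz\<close> and one in \<open>z\<close>; the two determinants turn these into
  adjugate entries.\<close>

lemma generating_function:
  "fps_of_poly (evalR (Dtpoly \<omega> a b) (uR * zR) * evalR (Dpoly \<omega> a b) zR) * Fseries \<omega>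
     = fps_of_poly (Ntilde \<omega> a b)"
proof -
  define p where "p J = Abs_fps (\<lambda>n. pow_column Bt.X (\<lambda>i j. Bt.T j i) {0..a - 1 - 1} n J)" for J
  define q where "q J = Abs_fps (\<lambda>n. pow_column B.X B.T {0..a - 1} n (insert (a - 1) J))" for J
  have col: "fps_of_poly (col (insert (a - 1) J)) = fps_of_poly (Dpoly \<omega> a b) * q J" if "J \<in> U_rows" for J
    unfolding col_def Dpoly_eq q_def
    using that insert_in_X_iff[of J] B.finite_X B.initial_in_X
    by (intro adj_id_minus_z_eq) (auto simp: U_rows_def)
  have row: "fps_of_poly (row J) = fps_of_poly (Dtpoly \<omega> a b) * p J" if "J \<in> U_rows" for J
  proof -
    have J: "J \<in> Bt.X" using that by (simp add: U_rows_def)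
    have "row J = adj_on Bt.X (id_minus_z (\<lambda>i j. Bt.T j i)) J {0..a - 1 - 1}"
      unfolding row_def id_minus_z_transpose[of Bt.T]
      by (rule adj_on_transpose[OF Bt.finite_X J Bt.initial_in_X, symmetric])
    moreover have "Dtpoly \<omega> a b = det_on Bt.X (id_minus_z (\<lambda>i j. Bt.T j i))"
      unfolding Dtpoly_eq id_minus_z_transpose[of Bt.T] by (rule det_on_transpose[OF Bt.finite_X, symmetric])
    ultimately show ?thesis
      using adj_id_minus_z_eq[OF Bt.finite_X J Bt.initial_in_X] by (simp add: p_def)
  qed
  have F: "Fseries \<omega> = (\<Sum>J\<in>U_rows. scale_fps (p J) * const_fps (q J))"
  proof (rule fps_ext)
    fix k
    have "fps_nth (\<Sum>J\<in>U_rows. scale_fps (p J) * const_fps (q J)) k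
        = (\<Sum>J\<in>U_rows. \<Sum>l\<le>k. monom (fps_nth (p J) l * fps_nth (q J) (k - l)) l)"
      by (simp add: fps_sum_nth fps_mult_nth scale_fps_def const_fps_def atLeast0AtMost
          smult_monom mult.commute)
    also have "\<dots> = (\<Sum>l\<le>k. monom (Fkl \<omega> k l) l)"
      by (subst sum.swap) (simp add: Fkl_eq p_def q_def monom_sum)
    finally show "fps_nth (Fseries \<omega>) k = fps_nth (\<Sum>J\<in>U_rows. scale_fps (p J) * const_fps (q J)) k"
      by (simp add: Fseries_def)
  qed
  have "fps_of_poly (Ntilde \<omega> a b)
      = (\<Sum>J\<in>U_rows. scale_fps (fps_of_poly (row J)) * const_fps (fps_of_poly (col (insert (a - 1) J))))"
    unfolding Ntilde_eq by (simp add: fps_of_poly_sum fps_of_poly_mult scale_fps_of_poly const_fps_of_poly)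
  also have "\<dots> = scale_fps (fps_of_poly (Dtpoly \<omega> a b)) * const_fps (fps_of_poly (Dpoly \<omega> a b)) * Fseries \<omega>"
    unfolding F sum_distrib_left
    by (intro sum.cong refl) (simp add: row col scale_fps_mult const_fps_mult mult_ac)
  finally show ?thesis
    by (simp add: fps_of_poly_mult scale_fps_of_poly const_fps_of_poly)
qed

text \<open>On \<open>U_rows\<close> the two factors have degree at most \<open>m\<close> and
  \<open>n\<close>, and the row factor attains \<open>m\<close> only at \<open>Jt\<close>, so
  nothing cancels.\<close>

lemma top_coeff_Ntilde:
  obtains c where "c \<noteq> 0"
    and "degree (Ntilde \<omega> a b) = (nat (a + b + 1) choose nat a) - nat (a + b + 1)"
    and "lead_coeff (Ntilde \<omega> a b) = monom c ((nat (a + b) choose nat (a - 1)) - nat a)"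
proof -
  define m where "m = card Bt.X - Suc (nat (a - 1))"
  define n where "n = card B.X - Suc (nat b)"
  \<comment> \<open>The state \<open>{1 - lo..\<alpha> - lo}\<close> at
    \<open>\<alpha> = a - 1\<close>, \<open>lo = b + 1\<close>. Adding \<open>a - 1\<close> gives
    exactly the state where the column factor attains \<open>n\<close>.\<close>
  define Jt where "Jt = {- b..a - 2 - b}"
  define c where "c = coeff (row Jt) m * coeff (col (insert (a - 1) Jt)) n"
  have row_top: "coeff (row J) m \<noteq> 0 \<longleftrightarrow> J = Jt" if "J \<in> U_rows" for J
    unfolding row_def m_def using Bt.top_coeffs_adj_row(3)[of J] that
    by (simp add: U_rows_def Jt_def algebra_simps)
  have row_deg: "degree (row J) \<le> m" if "J \<in> U_rows" for J
    unfolding row_def m_def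
    by (intro degree_le allI impI Bt.top_coeffs_adj_row(2)) (use that in \<open>auto simp: U_rows_def\<close>)
  have col_deg: "degree (col (insert (a - 1) J)) \<le> n" if "J \<in> U_rows" for J
    unfolding col_def n_def
    using that insert_in_X_iff[of J]
    by (intro degree_le allI impI B.top_coeffs_adj_column(2)[OF a]) (auto simp: U_rows_def)
  have Jt: "Jt \<in> U_rows"
    using a b by (auto simp: U_rows_def Jt_def Bt.X_iff)
  have col_top: "coeff (col (insert (a - 1) Jt)) n \<noteq> 0"
    unfolding col_def n_def
    using B.top_coeffs_adj_column(3)[OF a, of "insert (a - 1) Jt"] insert_in_X_iff[of Jt] Jt
    by (simp add: U_rows_def) (simp add: Jt_def)
  have c: "c \<noteq> 0" using col_top row_top[OF Jt] by (simp add: c_def)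
  have degs: "degree (evalR (row J) (uR * zR)) \<le> m" "degree (evalR (col (insert (a - 1) J)) zR) \<le> n"
    if "J \<in> U_rows" for J
    using row_deg[OF that] col_deg[OF that]
    by (auto intro!: degree_le simp: coeff_evalR_uR_zR coeff_evalR_zR coeff_eq_0)
  have deg_le: "degree (Ntilde \<omega> a b) \<le> m + n"
    unfolding Ntilde_eq
    by (intro degree_sum_le finite_U_rows order_trans[OF degree_mult_le] add_mono degs)
  have "coeff (Ntilde \<omega> a b) (m + n)
      = (\<Sum>J\<in>U_rows. monom (coeff (row J) m) m * [:coeff (col (insert (a - 1) J)) n:])"
    unfolding Ntilde_eq coeff_sum
    by (intro sum.cong refl) (simp only: coeff_mult_of_degree_le[OF degs] coeff_evalR_uR_zR coeff_evalR_zR)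
  also have "\<dots> = (\<Sum>J\<in>{Jt}. monom (coeff (row J) m) m * [:coeff (col (insert (a - 1) J)) n:])"
    using Jt finite_U_rows row_top by (intro sum.mono_neutral_right) auto
  also have "\<dots> = monom c m" by (simp add: c_def smult_monom mult.commute)
  finally have top: "coeff (Ntilde \<omega> a b) (m + n) = monom c m" .
  have deg: "degree (Ntilde \<omega> a b) = m + n"
    using deg_le le_degree[of "Ntilde \<omega> a b" "m + n"] top c by simp
  have cards: "card Bt.X = nat (a + b) choose nat (a - 1)" "card B.X = nat (a + b) choose nat a"
    using Bt.card_X B.card_X by simp_all
  have sa: "Suc (nat (a - 1)) = nat a" "nat (a + b + 1) = Suc (nat (a + b))" "nat (a + b) = nat a + nat b"
    using a b by auto
  have pascal: "nat (a + b + 1) choose nat a = card Bt.X + card B.X"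
    unfolding cards sa(2) sa(1)[symmetric] by simp
  \<comment> \<open>These bounds make the truncated subtractions in \<open>m\<close> and
    \<open>n\<close> exact.\<close>
  have "nat (a - 1) < card Bt.X" "nat b < card B.X"
    using Bt.top_coeffs_adj_row(1) B.top_coeffs_adj_column(1)[OF a] by auto
  then have "m + n = (nat (a + b + 1) choose nat a) - nat (a + b + 1)"
    unfolding pascal m_def n_def using sa by linarith
  moreover have "m = (nat (a + b) choose nat (a - 1)) - nat a"
    unfolding m_def cards sa ..
  ultimately show ?thesis using c deg top by (intro that[of c]) simp_all
qed

end

theorem mainTheorem9:
  fixes S :: "int set" and \<omega> :: "int \<Rightarrow> 'k::field_char_0" and a b :: int
  assumes "finite S" and "S \<noteq> {}"
    and "a = Max S" and "b = - Min S" and "a \<ge> 1" and "b \<ge> 1"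
    and "\<And>s. s \<notin> S \<Longrightarrow> \<omega> s = 0"
    and "\<omega> a \<noteq> 0" and "\<omega> (-b) \<noteq> 0"
  shows "fps_of_poly (evalR (Dtpoly \<omega> a b) (uR * zR) * evalR (Dpoly \<omega> a b) zR) * Fseries \<omega>
           = fps_of_poly (Ntilde \<omega> a b)
     \<and> degree (Dpoly \<omega> a b) = nat (a + b) choose nat a
     \<and> degree (Dtpoly \<omega> a b) = nat (a + b) choose nat (a - 1)
     \<and> degree (Ntilde \<omega> a b) = (nat (a + b + 1) choose nat a) - nat (a + b + 1)
     \<and> (\<exists>c. c \<noteq> 0 \<and> lead_coeff (Ntilde \<omega> a b) = monom c ((nat (a + b) choose nat (a - 1)) - nat a))"
proof -
  interpret step_weights \<omega> a b
  proof
    show "\<omega> s = 0" if "s < - b \<or> a < s" for s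
    proof (rule assms(7), rule notI)
      assume "s \<in> S"
      then have "s \<le> a" "- b \<le> s" using assms(1,3,4) by auto
      then show False using that by linarith
    qed
  qed (use assms in auto)
  have "degree (Dpoly \<omega> a b) = nat (a + b) choose nat a"
    using B.degree_det by (simp add: Dpoly_eq)
  moreover have "degree (Dtpoly \<omega> a b) = nat (a + b) choose nat (a - 1)"
    using Bt.degree_det by (simp add: Dtpoly_eq)
  moreover obtain c where "c \<noteq> 0"
    and "degree (Ntilde \<omega> a b) = (nat (a + b + 1) choose nat a) - nat (a + b + 1)"
    and "lead_coeff (Ntilde \<omega> a b) = monom c ((nat (a + b) choose nat (a - 1)) - nat a)"
    by (rule top_coeff_Ntilde)
  ultimately show ?thesis
    using generating_function by blast
qed

end
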